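(* Let $k\ge 1$ be a fixed integer. For each integer $n\ge k$ let $U^{(n)}=(U^{(n)}_{ij})_{1\le i,j\le n}$ be a random unitary $n\times n$ matrix distributed according to the normalized Haar measure on the unitary group $U(n)$. Let $(G_{ij})_{1\le i,j\le k}$ be a random $k\times k$ matrix whose entries are independent complex Gaussian random variables with mean $0$ and variance $\mathbb{E}|G_{ij}|^2=1$. Then the upper left $k\times k$ submatrix of $U^{(n)}$, multiplied by $\sqrt{n}$, converges in distribution to $(G_{ij})_{1\le i,j\le k}$ as $n\to\infty$; that is, the random matrices $(\sqrt{n}\,U^{(n)}_{ij})_{1\le i,j\le k}$ converge in distribution to $(G_{ij})_{1\le i,j\le k}$ as random elements of $\mathbb{C}^{k\times k}$. More generally, the same holds for any $k\times k$ submatrix: if for each $n\ge k$ one chooses non-random row indices $1\le r^{(n)}_1<\dots<r^{(n)}_k\le n$ and column indices $1\le c^{(n)}_1<\dots<c^{(n)}_k\le n$ (possibly depending on $n$), then $\bigl(\sqrt{n}\,U^{(n)}_{r^{(n)}_i c^{(n)}_j}\bigr)_{1\le i,j\le k}$ converges in distribution to $(G_{ij})_{1\le i,j\le k}$ as $n\to\infty$.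
   Context: $U(n)$ denotes the group of unitary $n\times n$ complex matrices, and the Haar measure on it is normalized to be a probability measure. A complex Gaussian random variable $G$ with mean $0$ and variance $\sigma^2$ means $G=X+iY$, where $X$ and $Y$ are independent real Gaussian random variables with $\mathbb{E}X=\mathbb{E}Y=0$ and $\mathbb{E}X^2=\mathbb{E}Y^2=\sigma^2/2$. Convergence in distribution means weak convergence of the (joint) probability distributions. *)

theory Defs
  imports
    "HOL-Probability.Probability"
    "Jordan_Normal_Form.Schur_Decomposition"
begin

definition borel_of :: "'a topology \<Rightarrow> 'a measure" where
  "borel_of T = sigma (topspace T) {S. openin T S}"

(* Weak convergence of finite Borel measures on a topological space.  The library's weak_conv and
   weak_conv_m only cover the real line. *)
definition weak_conv_on :: "'a topology \<Rightarrow> (nat \<Rightarrow> 'a measure) \<Rightarrow> 'a measure \<Rightarrow> bool" where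
  "weak_conv_on T \<mu> \<nu> \<longleftrightarrow>
     (\<forall>f :: 'a \<Rightarrow> real. continuous_map T euclideanreal f \<and> bounded (f ` topspace T) \<longrightarrow>
        (\<lambda>n. integral\<^sup>L (\<mu> n) f) \<longlonglongrightarrow> integral\<^sup>L \<nu> f)"

(* The random elements X n and Y may live on different probability spaces. *)
definition converges_in_distribution ::
    "'c topology \<Rightarrow> (nat \<Rightarrow> 'a measure) \<Rightarrow> (nat \<Rightarrow> 'a \<Rightarrow> 'c) \<Rightarrow> 'b measure \<Rightarrow> ('b \<Rightarrow> 'c) \<Rightarrow> bool" where
  "converges_in_distribution T M X N Y \<longleftrightarrow>
     weak_conv_on T (\<lambda>n. distr (M n) (borel_of T) (X n)) (distr N (borel_of T) Y)"

(* The matrices of a fixed size with the topology of entrywise convergence, i.e. the usual topology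
   of \<complex>^(m \<times> n), transported along the bijection sending a matrix to its family of entries. *)
definition mat_topology :: "nat \<Rightarrow> nat \<Rightarrow> complex mat topology" where
  "mat_topology m n =
     pullback_topology (carrier_mat m n)
       (\<lambda>A. \<lambda>ij\<in>{..<m} \<times> {..<n}. A $$ ij)
       (product_topology (\<lambda>_. euclidean) ({..<m} \<times> {..<n}))"

definition unitary_group :: "nat \<Rightarrow> complex mat set" where
  "unitary_group n = {A \<in> carrier_mat n n. mat_adjoint A * A = 1\<^sub>m n \<and> A * mat_adjoint A = 1\<^sub>m n}"

definition unitary_topology :: "nat \<Rightarrow> complex mat topology" where
  "unitary_topology n = subtopology (mat_topology n n) (unitary_group n)"

(* Since U(n) is compact and metrizable, regularity of a finite Borel measure is automatic, and
   left invariance together with total mass 1 characterizes the normalized Haar measure. *)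
definition normalized_haar_measure :: "nat \<Rightarrow> complex mat measure \<Rightarrow> bool" where
  "normalized_haar_measure n \<mu> \<longleftrightarrow>
     prob_space \<mu> \<and> sets \<mu> = sets (borel_of (unitary_topology n)) \<and>
     (\<forall>A \<in> unitary_group n. \<forall>S \<in> sets \<mu>. emeasure \<mu> ((\<lambda>B. A * B) ` S) = emeasure \<mu> S)"

definition haar_unitary :: "'a measure \<Rightarrow> nat \<Rightarrow> ('a \<Rightarrow> complex mat) \<Rightarrow> bool" where
  "haar_unitary M n U \<longleftrightarrow>
     U \<in> measurable M (borel_of (unitary_topology n)) \<and>
     normalized_haar_measure n (distr M (borel_of (unitary_topology n)) U)"

(* Centred complex Gaussian with E |Z|^2 = v.  The second parameter of normal_density is the
   standard deviation, so the real and imaginary parts have variance v / 2 each. *)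
definition complex_gaussian :: "'a measure \<Rightarrow> real \<Rightarrow> ('a \<Rightarrow> complex) \<Rightarrow> bool" where
  "complex_gaussian M v Z \<longleftrightarrow>
     distributed M lborel (\<lambda>\<omega>. Re (Z \<omega>)) (normal_density 0 (sqrt (v / 2))) \<and>
     distributed M lborel (\<lambda>\<omega>. Im (Z \<omega>)) (normal_density 0 (sqrt (v / 2))) \<and>
     prob_space.indep_var M borel (\<lambda>\<omega>. Re (Z \<omega>)) borel (\<lambda>\<omega>. Im (Z \<omega>))"

end

theory Submission
  imports Defs
begin

text \<open>
  The theorem rests on a coupling of the Haar unitary matrix $U$ with an independent Gaussian
  matrix, and on the invariance of the Haar measure under left multiplication by a fixed unitary
  matrix.

  Let $z$ be a $k \times n$ matrix of independent standard complex Gaussians, independent of $U$, and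
  consider the columns $c_1, \dots, c_k$ of $zU$. Integrating over $z$ first, with $U$ fixed, gives
  exactly the law of $(G_{ij})$, because the columns of $U$ are orthonormal and a standard Gaussian
  vector is unitarily invariant (\<open>gaussian_rows_times_orthonormal_columns\<close>). Integrating over $U$
  first, with $z$ fixed, gives almost the law of the block of $\sqrt n\, U$ with rows $r_i$ and columns
  $c_j$: by the law of large numbers the rows of $z / \sqrt n$ are nearly orthonormal
  (\<open>expectation_gram_deviation\<close>), hence close to orthonormal vectors
  (\<open>near_orthonormal_close_to_orthonormal\<close>), which complete to a unitary matrix $Q$ having these
  vectors in the positions $r_i$ (\<open>orthonormal_extension\<close>), and $QU$ has the same law as $U$. The
  replacement costs little since $\mathbb E\,|(vU)_c|^2 = |v|^2 / n$ for every fixed vector $v$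
  (\<open>combination_second_moment\<close>). By Fubini's theorem both orders of integration give the same
  number, and so \<open>haar_block_gaussian_error\<close> bounds the difference between the expectations of a
  test function under the two laws, with a bound that is uniform in the choice of rows and columns.

  Two auxiliary facts make this work for every bounded continuous test function $h$ and in every
  dimension. A bounded continuous $h$ has a modulus of continuity that is quadratic up to a small
  error weighted by $1 + |y|^2$ (\<open>array_test_function_quadratic_modulus\<close>), so that second moments
  alone control the error. Unitary invariance of the Gaussian
  law is read off from characteristic functions; the uniqueness theorem for joint characteristic
  functions (\<open>joint_distr_eq_of_char_eq\<close>) is obtained from Levy's theorem on the real line by
  treating the coordinates one at a time.

  For $z$ one may take $n$ independent copies of the first column of $(G_{ij})$, that is, the entries
  $G_{i0}(x_a)$ for $x$ in the $n$-fold product of the probability space that carries $G$.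
\<close>

section \<open>Random matrices as arrays of entries\<close>

lemma continuous_map_measurable_borel_of:
  assumes "continuous_map T T' g"
  shows "g \<in> measurable (borel_of T) (borel_of T')"
  unfolding borel_of_def
proof (rule measurable_measure_of)
  show "{S. openin T' S} \<subseteq> Pow (topspace T')"
    using openin_subset by auto
  show "g \<in> space (sigma (topspace T) {S. openin T S}) \<rightarrow> topspace T'"
    using assms by (auto simp: continuous_map_def space_measure_of_conv)
  fix S assume "S \<in> {S. openin T' S}"
  then have "openin T {x \<in> topspace T. g x \<in> S}"
    using assms by (auto simp: continuous_map_def)
  moreover have "g -` S \<inter> space (sigma (topspace T) {S. openin T S}) = {x \<in> topspace T. g x \<in> S}"
    by (auto simp: space_measure_of_conv)
  moreover have "{S. openin T S} \<subseteq> Pow (topspace T)"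
    using openin_subset by auto
  ultimately show "g -` S \<inter> space (sigma (topspace T) {S. openin T S})
      \<in> sets (sigma (topspace T) {S. openin T S})"
    by (simp add: sets_measure_of sigma_sets.Basic)
qed

lemma space_borel_of: "space (borel_of T) = topspace T"
  by (simp add: borel_of_def space_measure_of_conv)

lemma sets_borel_of_euclidean: "sets (borel_of euclidean) = sets (borel :: 'a::topological_space measure)"
  by (simp add: borel_of_def borel_def)

lemma borel_measurable_borel_ofI:
  fixes g :: "'a \<Rightarrow> 'b::topological_space"
  assumes "continuous_map T euclidean g"
  shows "g \<in> borel_measurable (borel_of T)"
  using continuous_map_measurable_borel_of[OF assms]
    measurable_cong_sets[OF refl sets_borel_of_euclidean] by blast

lemma topspace_mat_topology: "topspace (mat_topology m n) = carrier_mat m n"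
  by (auto simp: mat_topology_def topspace_pullback_topology)

lemma continuous_map_mat_entry:
  assumes "i < m" "j < n"
  shows "continuous_map (mat_topology m n) euclidean (\<lambda>A. A $$ (i, j))"
proof -
  have "continuous_map (product_topology (\<lambda>_. euclidean) ({..<m} \<times> {..<n})) euclidean (\<lambda>x. x (i, j))"
    by (rule continuous_map_product_projection) (use assms in auto)
  then have "continuous_map (mat_topology m n) euclidean
      ((\<lambda>x. x (i, j)) \<circ> (\<lambda>A. \<lambda>ij\<in>{..<m} \<times> {..<n}. A $$ ij))"
    unfolding mat_topology_def by (rule continuous_map_pullback)
  then show ?thesis using assms by (simp add: comp_def)
qed

lemma continuous_map_into_mat_topology:
  assumes "\<And>x. x \<in> topspace T \<Longrightarrow> g x \<in> carrier_mat m n"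
    and "\<And>i j. i < m \<Longrightarrow> j < n \<Longrightarrow> continuous_map T euclidean (\<lambda>x. g x $$ (i, j))"
  shows "continuous_map T (mat_topology m n) g"
  unfolding mat_topology_def
proof (rule continuous_map_pullback')
  show "continuous_map T (product_topology (\<lambda>_. euclidean) ({..<m} \<times> {..<n}))
          ((\<lambda>A. \<lambda>ij\<in>{..<m} \<times> {..<n}. A $$ ij) \<circ> g)"
    using assms(2) by (auto simp: continuous_map_componentwise comp_def)
  show "topspace T \<subseteq> g -` carrier_mat m n"
    using assms(1) by auto
qed

lemma continuous_map_mat: "continuous_map euclidean (mat_topology m n) (mat m n)"
  by (rule continuous_map_into_mat_topology) auto

text \<open>
  For a countable index set the Borel sets of the product topology are generated by the
  coordinates, so measurability of an array can be checked entrywise.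
\<close>
lemma borel_measurable_array:
  fixes x :: "'a \<Rightarrow> 'i::countable \<Rightarrow> 'c::second_countable_topology"
  assumes "\<And>p. (\<lambda>\<omega>. x \<omega> p) \<in> borel_measurable M"
  shows "x \<in> borel_measurable M"
proof -
  have "x \<in> measurable M (PiM UNIV (\<lambda>_. borel))"
    by (rule measurable_PiM_single') (use assms in auto)
  then show ?thesis
    using measurable_cong_sets[OF refl sets_PiM_equal_borel] by blast
qed

lemma measurable_mat_borel_of:
  assumes "\<And>p. p \<in> {..<m} \<times> {..<n} \<Longrightarrow> x p \<in> borel_measurable M"
  shows "(\<lambda>\<omega>. mat m n (\<lambda>p. x p \<omega>)) \<in> measurable M (borel_of (mat_topology m n))"
proof -
  let ?y = "\<lambda>\<omega> p. if p \<in> {..<m} \<times> {..<n} then x p \<omega> else 0"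
  have "?y \<in> borel_measurable M"
  proof (rule borel_measurable_array)
    show "(\<lambda>\<omega>. ?y \<omega> p) \<in> borel_measurable M" for p
      using assms[of p] by (cases "p \<in> {..<m} \<times> {..<n}") auto
  qed
  moreover have "mat m n \<in> measurable borel (borel_of (mat_topology m n))"
    using continuous_map_measurable_borel_of[OF continuous_map_mat]
      measurable_cong_sets[OF sets_borel_of_euclidean refl] by blast
  ultimately have "mat m n \<circ> ?y \<in> measurable M (borel_of (mat_topology m n))"
    by (rule measurable_comp)
  moreover have "mat m n \<circ> ?y = (\<lambda>\<omega>. mat m n (\<lambda>p. x p \<omega>))"
    by (auto intro!: eq_matI)
  ultimately show ?thesis by simp
qed

text \<open>
  Matrices are replaced by total arrays \<^typ>\<open>'i \<Rightarrow> complex\<close>: on that type topology, metric and Borel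
  sets are available by type class. A test function may look only at the entries in \<^term>\<open>P\<close>, which
  makes it a bounded continuous function of the corresponding block.
\<close>
definition array_test_function :: "'i set \<Rightarrow> (('i::countable \<Rightarrow> complex) \<Rightarrow> real) \<Rightarrow> bool" where
  "array_test_function P h \<longleftrightarrow> continuous_on UNIV h \<and> bounded (range h) \<and>
     (\<forall>x y. (\<forall>p\<in>P. x p = y p) \<longrightarrow> h x = h y)"

lemma array_test_function_cong:
  "array_test_function P h \<Longrightarrow> (\<And>p. p \<in> P \<Longrightarrow> x p = y p) \<Longrightarrow> h x = h y"
  unfolding array_test_function_def by blast

lemma array_test_function_bound:
  assumes "array_test_function P h"
  obtains B where "B > 0" "\<And>x. \<bar>h x\<bar> \<le> B"
proof -
  obtain B where "B > 0" "\<forall>y\<in>range h. norm y \<le> B"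
    using assms unfolding array_test_function_def bounded_pos by blast
  then show thesis using that[of B] by auto
qed

text \<open>
  Padding the entries outside \<^term>\<open>P\<close> by zero changes nothing, so measurability is needed only
  for the entries in the block.
\<close>
lemma array_test_function_measurable:
  assumes "array_test_function P h" "\<And>p. p \<in> P \<Longrightarrow> (\<lambda>\<omega>. x \<omega> p) \<in> borel_measurable M"
  shows "(\<lambda>\<omega>. h (x \<omega>)) \<in> borel_measurable M"
proof -
  let ?y = "\<lambda>\<omega> p. if p \<in> P then x \<omega> p else 0"
  have "?y \<in> borel_measurable M"
  proof (rule borel_measurable_array)
    show "(\<lambda>\<omega>. ?y \<omega> p) \<in> borel_measurable M" for p
      using assms(2)[of p] by (cases "p \<in> P") auto
  qed
  moreover have "h \<in> borel_measurable borel"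
    using assms(1) unfolding array_test_function_def
    by (intro borel_measurable_continuous_onI) auto
  ultimately have "(\<lambda>\<omega>. h (?y \<omega>)) \<in> borel_measurable M"
    by simp
  moreover have "h (?y \<omega>) = h (x \<omega>)" for \<omega>
    by (rule array_test_function_cong[OF assms(1)]) auto
  ultimately show ?thesis by simp
qed

text \<open>
  Reduces weak convergence on the space of matrices to test functions of arrays of entries. The
  threshold \<^term>\<open>n0\<close> is there because the spaces \<^term>\<open>M n\<close> carry a random matrix only for
  large \<^term>\<open>n\<close>.
\<close>
lemma converges_in_distribution_matI:
  fixes M :: "nat \<Rightarrow> 'a measure"
  assumes X: "\<And>n p. n \<ge> n0 \<Longrightarrow> p \<in> {..<k} \<times> {..<l} \<Longrightarrow> X n p \<in> borel_measurable (M n)"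
    and Y: "\<And>p. p \<in> {..<k} \<times> {..<l} \<Longrightarrow> Y p \<in> borel_measurable N"
    and lim: "\<And>h. array_test_function ({..<k} \<times> {..<l}) h \<Longrightarrow>
       (\<lambda>n. \<integral>\<omega>. h (\<lambda>p. X n p \<omega>) \<partial>M n) \<longlonglongrightarrow> (\<integral>\<omega>. h (\<lambda>p. Y p \<omega>) \<partial>N)"
  shows "converges_in_distribution (mat_topology k l) M (\<lambda>n \<omega>. mat k l (\<lambda>p. X n p \<omega>))
           N (\<lambda>\<omega>. mat k l (\<lambda>p. Y p \<omega>))"
  unfolding converges_in_distribution_def weak_conv_on_def
proof (intro allI impI, elim conjE)
  fix f :: "complex mat \<Rightarrow> real"
  assume f: "continuous_map (mat_topology k l) euclideanreal f"
    and bdd: "bounded (f ` topspace (mat_topology k l))"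
  define h where "h x = f (mat k l x)" for x
  have "continuous_map euclidean euclideanreal (f \<circ> mat k l)"
    by (rule continuous_map_compose[OF continuous_map_mat f])
  moreover have "range h \<subseteq> f ` topspace (mat_topology k l)"
    by (auto simp: h_def topspace_mat_topology)
  moreover have "mat k l x = mat k l y" if "\<forall>p\<in>{..<k} \<times> {..<l}. x p = y p" for x y :: "nat \<times> nat \<Rightarrow> complex"
    using that by (auto intro!: eq_matI)
  ultimately have h: "array_test_function ({..<k} \<times> {..<l}) h"
    unfolding array_test_function_def using bounded_subset[OF bdd]
    by (simp add: h_def comp_def) metis
  have *: "integral\<^sup>L (distr M' (borel_of (mat_topology k l)) (\<lambda>\<omega>. mat k l (\<lambda>p. Z p \<omega>))) f
      = (\<integral>\<omega>. h (\<lambda>p. Z p \<omega>) \<partial>M')"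
    if "\<And>p. p \<in> {..<k} \<times> {..<l} \<Longrightarrow> Z p \<in> borel_measurable M'" for M' :: "'x measure" and Z
    unfolding h_def by (rule integral_distr[OF measurable_mat_borel_of[OF that] borel_measurable_borel_ofI[OF f]])
  have "(\<lambda>n. \<integral>\<omega>. h (\<lambda>p. X n p \<omega>) \<partial>M n) \<longlonglongrightarrow>
      integral\<^sup>L (distr N (borel_of (mat_topology k l)) (\<lambda>\<omega>. mat k l (\<lambda>p. Y p \<omega>))) f"
    using lim[OF h] *[OF Y] by simp
  moreover have "\<forall>\<^sub>F n in sequentially. (\<integral>\<omega>. h (\<lambda>p. X n p \<omega>) \<partial>M n) =
      integral\<^sup>L (distr (M n) (borel_of (mat_topology k l)) (\<lambda>\<omega>. mat k l (\<lambda>p. X n p \<omega>))) f"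
    using eventually_ge_at_top[of n0] by eventually_elim (use *[OF X] in simp)
  ultimately show "(\<lambda>n. integral\<^sup>L (distr (M n) (borel_of (mat_topology k l)) (\<lambda>\<omega>. mat k l (\<lambda>p. X n p \<omega>))) f)
      \<longlonglongrightarrow> integral\<^sup>L (distr N (borel_of (mat_topology k l)) (\<lambda>\<omega>. mat k l (\<lambda>p. Y p \<omega>))) f"
    by (rule Lim_transform_eventually)
qed

text \<open>
  The metric of a countable product weights the coordinates by a geometric series of total
  mass two.
\<close>
lemma dist_fun_le:
  fixes x y :: "'i::countable \<Rightarrow> 'c::metric_space"
  assumes "\<And>p. dist (x p) (y p) \<le> e"
  shows "dist x y \<le> 2 * e"
proof -
  have s: "summable (\<lambda>n. (1/2)^n :: real)" by simp
  have "dist x y \<le> (\<Sum>n. (1/2)^n * e)"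
    unfolding dist_fun_def
  proof (rule suminf_le)
    show "(1/2)^n * min (dist (x (from_nat n)) (y (from_nat n))) 1 \<le> (1/2)^n * e" for n
      using assms[of "from_nat n"] by (intro mult_left_mono) auto
    show "summable (\<lambda>n. (1/2)^n * min (dist (x (from_nat n)) (y (from_nat n))) 1)"
      by (rule summable_comparison_test'[OF s]) auto
    show "summable (\<lambda>n. (1/2)^n * e)" using s by (rule summable_mult2)
  qed
  also have "\<dots> = 2 * e"
    by (subst suminf_mult2[symmetric]) (auto simp: suminf_geometric)
  finally show ?thesis .
qed

text \<open>
  Arrays that are bounded by \<^term>\<open>R\<close> on \<^term>\<open>P\<close> and vanish elsewhere form a compact set by
  Tychonoff's theorem, so the test function is uniformly continuous there.
\<close>
lemma array_test_function_uniform_on_box: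
  fixes P :: "'i::countable set"
  assumes h: "array_test_function P h" and "e > 0"
  obtains d where "d > 0" "d \<le> 1"
    "\<And>x y. (\<And>p. p \<in> P \<Longrightarrow> cmod (x p) \<le> R) \<Longrightarrow> (\<And>p. p \<in> P \<Longrightarrow> cmod (y p) \<le> R) \<Longrightarrow>
       (\<And>p. p \<in> P \<Longrightarrow> cmod (x p - y p) \<le> d) \<Longrightarrow> \<bar>h x - h y\<bar> < e"
proof -
  let ?K = "\<lambda>p. if p \<in> P then cball 0 R else {0::complex}"
  have "compactin (product_topology (\<lambda>_. euclidean) UNIV) (PiE UNIV ?K)"
    by (subst compactin_PiE) auto
  then have "compact (PiE UNIV ?K)"
    by (simp add: euclidean_product_topology)
  moreover have "continuous_on (PiE UNIV ?K) h"
    using h continuous_on_subset unfolding array_test_function_def by blast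
  ultimately have "uniformly_continuous_on (PiE UNIV ?K) h"
    by (rule compact_uniformly_continuous[rotated])
  then obtain d where d: "d > 0" "\<And>x y. x \<in> PiE UNIV ?K \<Longrightarrow> y \<in> PiE UNIV ?K \<Longrightarrow> dist x y < d \<Longrightarrow> dist (h x) (h y) < e"
    unfolding uniformly_continuous_on_def using \<open>e > 0\<close> by metis
  show thesis
  proof (rule that[of "min 1 (d / 3)"])
    fix x y :: "'i \<Rightarrow> complex"
    assume x: "\<And>p. p \<in> P \<Longrightarrow> cmod (x p) \<le> R" and y: "\<And>p. p \<in> P \<Longrightarrow> cmod (y p) \<le> R"
      and xy: "\<And>p. p \<in> P \<Longrightarrow> cmod (x p - y p) \<le> min 1 (d / 3)"
    let ?x = "\<lambda>p. if p \<in> P then x p else 0" and ?y = "\<lambda>p. if p \<in> P then y p else 0"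
    have "dist ?x ?y \<le> 2 * (d / 3)"
      by (rule dist_fun_le) (use xy \<open>d > 0\<close> in \<open>auto simp: dist_norm\<close>)
    then have "dist ?x ?y < d" using \<open>d > 0\<close> by simp
    then have "dist (h ?x) (h ?y) < e"
      by (intro d(2)) (use x y in \<open>auto simp: PiE_iff\<close>)
    moreover have "h ?x = h x" "h ?y = h y"
      by (rule array_test_function_cong[OF h], simp)+
    ultimately show "\<bar>h x - h y\<bar> < e" by (simp add: dist_norm)
  qed (use \<open>d > 0\<close> in auto)
qed

text \<open>
  Outside a large ball the trivial bound by twice the supremum is absorbed by the term with
  \<open>(cmod (y p))\<^sup>2\<close>, for distant points by the term with \<^term>\<open>K\<close>, and for close points in the ball
  uniform continuity applies. With this bound, closeness of two random arrays in mean square gives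
  closeness of the expectations of \<^term>\<open>h\<close> as soon as one of the arrays is bounded in mean square.
\<close>
lemma array_test_function_quadratic_modulus:
  assumes h: "array_test_function P h" and "finite P" and "e > 0"
  obtains K where "K \<ge> 0"
    "\<And>x y. \<bar>h x - h y\<bar> \<le> e * (1 + (\<Sum>p\<in>P. (cmod (y p))\<^sup>2)) + K * (\<Sum>p\<in>P. (cmod (x p - y p))\<^sup>2)"
proof -
  obtain B where B: "B > 0" "\<And>x. \<bar>h x\<bar> \<le> B"
    using array_test_function_bound[OF h] by metis
  define R where "R = sqrt (2 * B / e)"
  have R2: "e * R\<^sup>2 = 2 * B" using B(1) \<open>e > 0\<close> by (simp add: R_def)
  obtain d where d: "d > 0" "d \<le> 1"
    "\<And>x y. (\<And>p. p \<in> P \<Longrightarrow> cmod (x p) \<le> R + 1) \<Longrightarrow> (\<And>p. p \<in> P \<Longrightarrow> cmod (y p) \<le> R + 1) \<Longrightarrow>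
       (\<And>p. p \<in> P \<Longrightarrow> cmod (x p - y p) \<le> d) \<Longrightarrow> \<bar>h x - h y\<bar> < e"
    using array_test_function_uniform_on_box[OF h \<open>e > 0\<close>, of "R + 1"] by metis
  show thesis
  proof (rule that[of "2 * B / d\<^sup>2"])
    show "0 \<le> 2 * B / d\<^sup>2" using B by simp
    fix x y
    let ?S = "\<Sum>p\<in>P. (cmod (y p))\<^sup>2" and ?D = "\<Sum>p\<in>P. (cmod (x p - y p))\<^sup>2"
    have S0: "?S \<ge> 0" and D0: "?D \<ge> 0" by (auto intro: sum_nonneg)
    have triv: "\<bar>h x - h y\<bar> \<le> 2 * B" using B(2)[of x] B(2)[of y] by linarith
    have KD: "2 * B / d\<^sup>2 * ?D \<ge> 0" using B(1) D0 by simp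
    consider "?S \<ge> R\<^sup>2" | "?D \<ge> d\<^sup>2" | "?S < R\<^sup>2" "?D < d\<^sup>2" by linarith
    then show "\<bar>h x - h y\<bar> \<le> e * (1 + ?S) + 2 * B / d\<^sup>2 * ?D"
    proof cases
      case 1
      then have "2 * B \<le> e * ?S" using R2 \<open>e > 0\<close> by (metis mult_le_cancel_left_pos)
      with triv KD \<open>e > 0\<close> show ?thesis unfolding distrib_left by linarith
    next
      case 2
      have "2 * B = 2 * B / d\<^sup>2 * d\<^sup>2" using d(1) by simp
      also have "\<dots> \<le> 2 * B / d\<^sup>2 * ?D" using 2 B(1) by (intro mult_left_mono) auto
      finally have "2 * B \<le> 2 * B / d\<^sup>2 * ?D" .
      moreover have "0 \<le> e * (1 + ?S)" using \<open>e > 0\<close> S0 by simp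
      ultimately show ?thesis using triv by linarith
    next
      case 3
      have R0: "R \<ge> 0" using B(1) \<open>e > 0\<close> by (simp add: R_def)
      have yb: "cmod (y p) \<le> R" if "p \<in> P" for p
      proof -
        have "(cmod (y p))\<^sup>2 \<le> ?S" using that \<open>finite P\<close> by (intro member_le_sum[of p P "\<lambda>p. (cmod (y p))\<^sup>2"]) auto
        then show ?thesis using 3(1) by (rule power2_le_imp_le[OF less_imp_le[OF le_less_trans] R0])
      qed
      have db: "cmod (x p - y p) \<le> d" if "p \<in> P" for p
      proof -
        have "(cmod (x p - y p))\<^sup>2 \<le> ?D"
          using that \<open>finite P\<close> by (intro member_le_sum[of p P "\<lambda>p. (cmod (x p - y p))\<^sup>2"]) auto
        then show ?thesis using 3(2) by (rule power2_le_imp_le[OF less_imp_le[OF le_less_trans] less_imp_le[OF d(1)]])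
      qed
      have "\<bar>h x - h y\<bar> < e"
      proof (rule d(3))
        fix p assume p: "p \<in> P"
        show "cmod (y p) \<le> R + 1" using yb[OF p] by simp
        have "cmod (x p) \<le> cmod (y p) + cmod (x p - y p)" by (metis add.commute diff_add_cancel norm_triangle_ineq)
        then show "cmod (x p) \<le> R + 1" using yb[OF p] db[OF p] d(2) by linarith
      qed (use db in auto)
      moreover have "0 \<le> e * ?S" using \<open>e > 0\<close> S0 by simp
      ultimately show ?thesis using KD unfolding distrib_left by linarith
    qed
  qed
qed

section \<open>Joint characteristic functions determine the law\<close>

text \<open>
  Levy's uniqueness theorem for probability measures with a bounded density. The lower bound on
  the weights makes their total mass positive, so that they can be normalised; the interval from 1 to
  3 is the range of \<open>2 + Re c\<close> for \<open>cmod c \<le> 1\<close>.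
\<close>
lemma weighted_distr_eq_of_char_eq:
  fixes g :: "'a \<Rightarrow> real" and g' :: "'b \<Rightarrow> real"
  assumes M: "prob_space M" and N: "prob_space N"
    and [measurable]: "g \<in> borel_measurable M" "X \<in> borel_measurable M"
      "g' \<in> borel_measurable N" "Y \<in> borel_measurable N"
    and g: "\<And>\<omega>. 1 \<le> g \<omega>" "\<And>\<omega>. g \<omega> \<le> 3" and g': "\<And>\<omega>. 1 \<le> g' \<omega>" "\<And>\<omega>. g' \<omega> \<le> 3"
    and eq: "\<And>s. (\<integral>\<omega>. of_real (g \<omega>) * iexp (s * X \<omega>) \<partial>M) = (\<integral>\<omega>. of_real (g' \<omega>) * iexp (s * Y \<omega>) \<partial>N)"
    and B: "B \<in> sets borel"
  shows "(\<integral>\<omega>. g \<omega> * indicator B (X \<omega>) \<partial>M) = (\<integral>\<omega>. g' \<omega> * indicator B (Y \<omega>) \<partial>N)"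
proof -
  define m where "m = (\<integral>\<omega>. g \<omega> \<partial>M)"
  have m': "m = (\<integral>\<omega>. g' \<omega> \<partial>N)"
  proof -
    have "complex_of_real m = of_real (\<integral>\<omega>. g' \<omega> \<partial>N)"
      using eq[of 0] by (simp add: m_def)
    then show ?thesis by (simp only: of_real_eq_iff)
  qed
  \<comment> \<open>normalising by the common mass turns both weighted laws into probability laws on the line\<close>
  have law: "real_distribution (distr (density L (\<lambda>\<omega>. ennreal (f \<omega> / m))) borel Z)
     \<and> m > 0 \<and> char (distr (density L (\<lambda>\<omega>. ennreal (f \<omega> / m))) borel Z) =
          (\<lambda>s. (\<integral>\<omega>. of_real (f \<omega>) * iexp (s * Z \<omega>) \<partial>L) / of_real m)
     \<and> measure (distr (density L (\<lambda>\<omega>. ennreal (f \<omega> / m))) borel Z) B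
        = (\<integral>\<omega>. f \<omega> * indicator B (Z \<omega>) \<partial>L) / m"
    if L: "prob_space L" and [measurable]: "f \<in> borel_measurable L" "Z \<in> borel_measurable L"
      and f: "\<And>\<omega>. 1 \<le> f \<omega>" "\<And>\<omega>. f \<omega> \<le> 3" and mf: "m = (\<integral>\<omega>. f \<omega> \<partial>L)"
    for L :: "'c measure" and f Z
  proof -
    interpret L: prob_space L by fact
    have f0: "0 \<le> f \<omega>" for \<omega> using f(1)[of \<omega>] by linarith
    have int: "integrable L f"
      by (rule L.integrable_const_bound[of _ 3]) (use f f0 in auto)
    have "1 \<le> m" unfolding mf
      using L.integral_ge_const[OF int, of 1] f(1) by simp
    then have mpos: "m > 0" by simp
    let ?D = "density L (\<lambda>\<omega>. ennreal (f \<omega> / m))"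
    have nn: "0 \<le> f \<omega> / m" for \<omega> using f0 mpos by simp
    have "emeasure ?D (space ?D) = (\<integral>\<^sup>+\<omega>. ennreal (f \<omega> / m) \<partial>L)"
      by (simp add: emeasure_density cong: nn_integral_cong)
    also have "\<dots> = ennreal (\<integral>\<omega>. f \<omega> / m \<partial>L)"
      by (rule nn_integral_eq_integral) (use int nn in auto)
    also have "\<dots> = 1" using mf[symmetric] mpos by simp
    finally have D: "prob_space ?D" by (rule prob_spaceI)
    interpret D: prob_space ?D by (rule D)
    have 1: "real_distribution (distr ?D borel Z)"
      by (rule D.real_distribution_distr) simp
    have 2: "char (distr ?D borel Z) s = (\<integral>\<omega>. of_real (f \<omega>) * iexp (s * Z \<omega>) \<partial>L) / of_real m" for s
    proof -
      have "char (distr ?D borel Z) s = (\<integral>\<omega>. iexp (s * Z \<omega>) \<partial>?D)"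
        unfolding char_def by (rule integral_distr) auto
      also have "\<dots> = (\<integral>\<omega>. (f \<omega> / m) *\<^sub>R iexp (s * Z \<omega>) \<partial>L)"
        by (rule integral_density) (use nn in auto)
      also have "\<dots> = (\<integral>\<omega>. of_real (f \<omega>) * iexp (s * Z \<omega>) / of_real m \<partial>L)"
        by (simp add: scaleR_conv_of_real)
      finally show ?thesis by simp
    qed
    have 3: "measure (distr ?D borel Z) B = (\<integral>\<omega>. f \<omega> * indicator B (Z \<omega>) \<partial>L) / m"
    proof -
      have "measure (distr ?D borel Z) B = (\<integral>x. indicator B x \<partial>distr ?D borel Z)"
        using B by simp
      also have "\<dots> = (\<integral>\<omega>. indicator B (Z \<omega>) \<partial>?D)"
        by (rule integral_distr) (use B in auto)
      also have "\<dots> = (\<integral>\<omega>. (f \<omega> / m) *\<^sub>R indicator B (Z \<omega>) \<partial>L)"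
        by (rule integral_density) (use nn B in auto)
      also have "\<dots> = (\<integral>\<omega>. f \<omega> * indicator B (Z \<omega>) / m \<partial>L)" by simp
      finally show ?thesis by simp
    qed
    show ?thesis by (intro conjI ext 1 2 3 mpos)
  qed
  note lM = law[OF M \<open>g \<in> _\<close> \<open>X \<in> _\<close> g m_def] and lN = law[OF N \<open>g' \<in> _\<close> \<open>Y \<in> _\<close> g' m']
  have "distr (density M (\<lambda>\<omega>. ennreal (g \<omega> / m))) borel X = distr (density N (\<lambda>\<omega>. ennreal (g' \<omega> / m))) borel Y"
  proof (rule Levy_uniqueness)
    show "char (distr (density M (\<lambda>\<omega>. ennreal (g \<omega> / m))) borel X) =
        char (distr (density N (\<lambda>\<omega>. ennreal (g' \<omega> / m))) borel Y)"
      using lM[THEN conjunct2, THEN conjunct2, THEN conjunct1] lN[THEN conjunct2, THEN conjunct2, THEN conjunct1]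
      by (simp only: eq)
  qed (rule lM[THEN conjunct1] lN[THEN conjunct1])+
  then have "(\<integral>\<omega>. g \<omega> * indicator B (X \<omega>) \<partial>M) / m = (\<integral>\<omega>. g' \<omega> * indicator B (Y \<omega>) \<partial>N) / m"
    using lM[THEN conjunct2, THEN conjunct2, THEN conjunct2] lN[THEN conjunct2, THEN conjunct2, THEN conjunct2]
    by (simp only:)
  then show ?thesis using lM[THEN conjunct2, THEN conjunct1] by simp
qed

text \<open>
  A complex weight \<^term>\<open>c\<close> is reduced to positive ones. Conjugation turns the transform of
  \<^term>\<open>c\<close> at \<open>s\<close> into that of its conjugate at \<open>-s\<close>, so the transforms of the real part of
  \<^term>\<open>c\<close> agree as well; adding the constant 2 makes it positive, and the contribution of the
  constant is known from the first transform. The imaginary part is the real part of \<open>- \<i> * c\<close>.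
\<close>
lemma complex_weighted_distr_eq_of_char_eq:
  fixes c :: "'a \<Rightarrow> complex" and c' :: "'b \<Rightarrow> complex"
  assumes M: "prob_space M" and N: "prob_space N"
    and [measurable]: "c \<in> borel_measurable M" "X \<in> borel_measurable M"
      "c' \<in> borel_measurable N" "Y \<in> borel_measurable N"
    and c: "\<And>\<omega>. cmod (c \<omega>) \<le> 1" and c': "\<And>\<omega>. cmod (c' \<omega>) \<le> 1"
    and eq1: "\<And>s. (\<integral>\<omega>. iexp (s * X \<omega>) \<partial>M) = (\<integral>\<omega>. iexp (s * Y \<omega>) \<partial>N)"
    and eq: "\<And>s. (\<integral>\<omega>. c \<omega> * iexp (s * X \<omega>) \<partial>M) = (\<integral>\<omega>. c' \<omega> * iexp (s * Y \<omega>) \<partial>N)"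
    and B[measurable]: "B \<in> sets borel"
  shows "(\<integral>\<omega>. c \<omega> * indicator B (X \<omega>) \<partial>M) = (\<integral>\<omega>. c' \<omega> * indicator B (Y \<omega>) \<partial>N)"
proof -
  interpret M: prob_space M by fact
  interpret N: prob_space N by fact
  have int: "integrable L f" if "prob_space L" "f \<in> borel_measurable L" "\<And>\<omega>. norm (f \<omega>) \<le> K"
    for L :: "'c measure" and f :: "'c \<Rightarrow> 'd::{second_countable_topology,banach}" and K :: real
  proof -
    interpret prob_space L by fact
    show ?thesis by (rule integrable_const_bound[of _ K]) (use that in auto)
  qed
  have re: "(\<integral>\<omega>. Re (d \<omega>) * indicator B (X \<omega>) \<partial>M) = (\<integral>\<omega>. Re (d' \<omega>) * indicator B (Y \<omega>) \<partial>N)"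
    if [measurable]: "d \<in> borel_measurable M" "d' \<in> borel_measurable N"
      and d: "\<And>\<omega>. cmod (d \<omega>) \<le> 1" and d': "\<And>\<omega>. cmod (d' \<omega>) \<le> 1"
      and deq: "\<And>s. (\<integral>\<omega>. d \<omega> * iexp (s * X \<omega>) \<partial>M) = (\<integral>\<omega>. d' \<omega> * iexp (s * Y \<omega>) \<partial>N)"
    for d d'
  proof -
    have expand: "(\<integral>\<omega>. of_real (2 + Re (f \<omega>)) * iexp (s * Z \<omega>) \<partial>L) =
        2 * (\<integral>\<omega>. iexp (s * Z \<omega>) \<partial>L) + ((\<integral>\<omega>. f \<omega> * iexp (s * Z \<omega>) \<partial>L)
          + cnj (\<integral>\<omega>. f \<omega> * iexp (- s * Z \<omega>) \<partial>L)) / 2"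
      if L: "prob_space L" and [measurable]: "f \<in> borel_measurable L" "Z \<in> borel_measurable L"
        and f: "\<And>\<omega>. cmod (f \<omega>) \<le> 1"
      for L :: "'c measure" and f Z s
    proof -
      have i1: "integrable L (\<lambda>\<omega>. iexp (s * Z \<omega>))" by (rule int[OF L, of _ 1]) auto
      have i2: "integrable L (\<lambda>\<omega>. f \<omega> * iexp (s * Z \<omega>))" for s
        by (rule int[OF L, of _ 1]) (use f in \<open>auto simp: norm_mult\<close>)
      have i3: "integrable L (\<lambda>\<omega>. cnj (f \<omega> * iexp (- s * Z \<omega>)))"
        using i2[of "-s"] by (rule integrable_cnj)
      have "of_real (2 + Re (f \<omega>)) * iexp (s * Z \<omega>) =
          2 * iexp (s * Z \<omega>) + (f \<omega> * iexp (s * Z \<omega>) + cnj (f \<omega> * iexp (- s * Z \<omega>))) / 2" for \<omega>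
      proof -
        define E where "E = iexp (s * Z \<omega>)"
        have E: "cnj (iexp (- s * Z \<omega>)) = E"
          by (simp add: E_def exp_cnj)
        have "complex_of_real (2 + Re (f \<omega>)) = 2 + (f \<omega> + cnj (f \<omega>)) / 2"
          by (simp add: complex_add_cnj)
        then show ?thesis
          unfolding E_def[symmetric] complex_cnj_mult E by (simp add: field_simps)
      qed
      then have "(\<integral>\<omega>. of_real (2 + Re (f \<omega>)) * iexp (s * Z \<omega>) \<partial>L) =
          (\<integral>\<omega>. 2 * iexp (s * Z \<omega>) + (f \<omega> * iexp (s * Z \<omega>) + cnj (f \<omega> * iexp (- s * Z \<omega>))) / 2 \<partial>L)"
        by presburger
      also have "\<dots> = 2 * (\<integral>\<omega>. iexp (s * Z \<omega>) \<partial>L) + ((\<integral>\<omega>. f \<omega> * iexp (s * Z \<omega>) \<partial>L)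
          + (\<integral>\<omega>. cnj (f \<omega> * iexp (- s * Z \<omega>)) \<partial>L)) / 2"
        using i1 i2[of s] i3 by (simp del: complex_cnj_mult)
      also have "(\<integral>\<omega>. cnj (f \<omega> * iexp (- s * Z \<omega>)) \<partial>L) = cnj (\<integral>\<omega>. f \<omega> * iexp (- s * Z \<omega>) \<partial>L)"
        by (rule Bochner_Integration.integral_cnj)
      finally show ?thesis .
    qed
    have *: "1 \<le> 2 + Re (d \<omega>)" "2 + Re (d \<omega>) \<le> 3" for \<omega>
      using abs_Re_le_cmod[of "d \<omega>"] d[of \<omega>] by linarith+
    have **: "1 \<le> 2 + Re (d' \<omega>)" "2 + Re (d' \<omega>) \<le> 3" for \<omega>
      using abs_Re_le_cmod[of "d' \<omega>"] d'[of \<omega>] by linarith+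
    have w: "(\<integral>\<omega>. (2 + Re (d \<omega>)) * indicator B (X \<omega>) \<partial>M) = (\<integral>\<omega>. (2 + Re (d' \<omega>)) * indicator B (Y \<omega>) \<partial>N)"
    proof (rule weighted_distr_eq_of_char_eq[OF M N _ _ _ _ * ** _ B])
      show "(\<integral>\<omega>. of_real (2 + Re (d \<omega>)) * iexp (s * X \<omega>) \<partial>M) =
          (\<integral>\<omega>. of_real (2 + Re (d' \<omega>)) * iexp (s * Y \<omega>) \<partial>N)" for s
        unfolding expand[OF M \<open>d \<in> _\<close> \<open>X \<in> _\<close> d] expand[OF N \<open>d' \<in> _\<close> \<open>Y \<in> _\<close> d'] eq1 deq ..
    qed measurable
    have w1: "(\<integral>\<omega>. 1 * indicator B (X \<omega>) \<partial>M) = (\<integral>\<omega>. 1 * indicator B (Y \<omega>) \<partial>N :: real)"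
    proof (rule weighted_distr_eq_of_char_eq[OF M N _ _ _ _ _ _ _ _ _ B])
      show "(\<integral>\<omega>. of_real 1 * iexp (s * X \<omega>) \<partial>M) = (\<integral>\<omega>. of_real 1 * iexp (s * Y \<omega>) \<partial>N)" for s
        unfolding of_real_1 mult_1 by (rule eq1)
    qed auto
    have split: "(\<integral>\<omega>. (2 + Re (f \<omega>)) * indicator B (Z \<omega>) \<partial>L) =
        2 * (\<integral>\<omega>. 1 * indicator B (Z \<omega>) \<partial>L) + (\<integral>\<omega>. Re (f \<omega>) * indicator B (Z \<omega>) \<partial>L)"
      if L: "prob_space L" and [measurable]: "f \<in> borel_measurable L" "Z \<in> borel_measurable L"
        and f: "\<And>\<omega>. cmod (f \<omega>) \<le> 1"
      for L :: "'c measure" and f Z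
    proof -
      have i1: "integrable L (\<lambda>\<omega>. 1 * indicator B (Z \<omega>) :: real)"
        by (rule int[OF L, of _ 1]) (auto simp: indicator_def)
      have i2: "integrable L (\<lambda>\<omega>. Re (f \<omega>) * indicator B (Z \<omega>))"
        by (rule int[OF L, of _ 1]) (auto simp: indicator_def abs_mult intro: order_trans[OF abs_Re_le_cmod f])
      have "(\<integral>\<omega>. (2 + Re (f \<omega>)) * indicator B (Z \<omega>) \<partial>L) =
          (\<integral>\<omega>. 2 * (1 * indicator B (Z \<omega>)) + Re (f \<omega>) * indicator B (Z \<omega>) \<partial>L)"
        by (simp add: distrib_right)
      also have "\<dots> = 2 * (\<integral>\<omega>. 1 * indicator B (Z \<omega>) \<partial>L) + (\<integral>\<omega>. Re (f \<omega>) * indicator B (Z \<omega>) \<partial>L)"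
        using i1 i2 by (subst Bochner_Integration.integral_add) auto
      finally show ?thesis .
    qed
    show ?thesis
      using w w1 split[OF M \<open>d \<in> _\<close> \<open>X \<in> _\<close> d] split[OF N \<open>d' \<in> _\<close> \<open>Y \<in> _\<close> d'] by simp
  qed
  have "(\<integral>\<omega>. c \<omega> * indicator B (Z \<omega>) \<partial>L) =
      Complex (\<integral>\<omega>. Re (c \<omega>) * indicator B (Z \<omega>) \<partial>L) (\<integral>\<omega>. Re (- \<i> * c \<omega>) * indicator B (Z \<omega>) \<partial>L)"
    if L: "prob_space L" and [measurable]: "c \<in> borel_measurable L" "Z \<in> borel_measurable L"
      and c: "\<And>\<omega>. cmod (c \<omega>) \<le> 1"
    for L :: "'c measure" and c Z
  proof -
    have "integrable L (\<lambda>\<omega>. c \<omega> * indicator B (Z \<omega>))"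
      by (rule int[OF L, of _ 1]) (use c in \<open>auto simp: indicator_def\<close>)
    then have "Re (\<integral>\<omega>. c \<omega> * indicator B (Z \<omega>) \<partial>L) = (\<integral>\<omega>. Re (c \<omega> * indicator B (Z \<omega>)) \<partial>L)"
        "Im (\<integral>\<omega>. c \<omega> * indicator B (Z \<omega>) \<partial>L) = (\<integral>\<omega>. Im (c \<omega> * indicator B (Z \<omega>)) \<partial>L)"
      by (simp_all only: Bochner_Integration.integral_Re Bochner_Integration.integral_Im)
    moreover have "Re (c \<omega> * indicator B (Z \<omega>)) = Re (c \<omega>) * indicator B (Z \<omega>)"
        "Im (c \<omega> * indicator B (Z \<omega>)) = Re (- \<i> * c \<omega>) * indicator B (Z \<omega>)" for \<omega>
      by (auto simp: indicator_def)
    ultimately show ?thesis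
      by (simp only: complex_eq_iff complex.sel simp_thms)
  qed
  note cplx = this
  have "(\<integral>\<omega>. Re (c \<omega>) * indicator B (X \<omega>) \<partial>M) = (\<integral>\<omega>. Re (c' \<omega>) * indicator B (Y \<omega>) \<partial>N)"
    by (rule re) (use c c' eq in auto)
  moreover have "(\<integral>\<omega>. Re (- \<i> * c \<omega>) * indicator B (X \<omega>) \<partial>M) = (\<integral>\<omega>. Re (- \<i> * c' \<omega>) * indicator B (Y \<omega>) \<partial>N)"
  proof (rule re)
    show "(\<integral>\<omega>. - \<i> * c \<omega> * iexp (s * X \<omega>) \<partial>M) = (\<integral>\<omega>. - \<i> * c' \<omega> * iexp (s * Y \<omega>) \<partial>N)" for s
      unfolding mult.assoc integral_mult_right_zero eq ..
  qed (use c c' in \<open>auto simp: norm_mult\<close>)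
  ultimately show ?thesis
    using cplx[OF M \<open>c \<in> _\<close> \<open>X \<in> _\<close> c] cplx[OF N \<open>c' \<in> _\<close> \<open>Y \<in> _\<close> c'] by simp
qed

text \<open>
  The induction that lifts the one-dimensional theorem to several coordinates: the exponential
  factors are exchanged for indicators one coordinate at a time. In the step for \<^term>\<open>j\<close>, the
  indicators obtained so far together with the exponentials of the remaining coordinates form the
  complex weight of the preceding lemma.
\<close>
lemma char_eq_imp_partial_box_eq:
  fixes X :: "'i \<Rightarrow> 'a \<Rightarrow> real" and Y :: "'i \<Rightarrow> 'b \<Rightarrow> real"
  assumes M: "prob_space M" and N: "prob_space N" and I: "finite I"
    and X: "\<And>i. i \<in> I \<Longrightarrow> X i \<in> borel_measurable M"
    and Y: "\<And>i. i \<in> I \<Longrightarrow> Y i \<in> borel_measurable N"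
    and eq: "\<And>t. (\<integral>\<omega>. iexp (\<Sum>i\<in>I. t i * X i \<omega>) \<partial>M) = (\<integral>\<omega>. iexp (\<Sum>i\<in>I. t i * Y i \<omega>) \<partial>N)"
    and B: "\<And>i. i \<in> I \<Longrightarrow> B i \<in> sets borel"
    and J: "finite J" "J \<subseteq> I"
  shows "(\<integral>\<omega>. (\<Prod>j\<in>J. indicator (B j) (X j \<omega>)) * iexp (\<Sum>i\<in>I - J. t i * X i \<omega>) \<partial>M) =
         (\<integral>\<omega>. (\<Prod>j\<in>J. indicator (B j) (Y j \<omega>)) * iexp (\<Sum>i\<in>I - J. t i * Y i \<omega>) \<partial>N)"
  using J
proof (induction J arbitrary: t rule: finite_induct)
  case empty
  then show ?case using eq by simp
next
  case (insert j J)
  then have j: "j \<in> I" "j \<notin> J" and J: "J \<subseteq> I" by auto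
  let ?c = "\<lambda>Z \<omega>. (\<Prod>j\<in>J. indicator (B j) (Z j \<omega>)) * iexp (\<Sum>i\<in>I - insert j J. t i * Z i \<omega>) :: complex"
  have meas: "?c Z \<in> borel_measurable L" if "\<And>i. i \<in> I \<Longrightarrow> Z i \<in> borel_measurable L" for Z and L :: "'c measure"
  proof -
    have [measurable]: "(\<lambda>\<omega>. \<Prod>j\<in>J. indicator (B j) (Z j \<omega>) :: complex) \<in> borel_measurable L"
    proof (rule borel_measurable_prod)
      fix i assume "i \<in> J"
      then have [measurable]: "Z i \<in> borel_measurable L" "B i \<in> sets borel" using that B J by auto
      show "(\<lambda>\<omega>. indicator (B i) (Z i \<omega>) :: complex) \<in> borel_measurable L" by measurable
    qed
    have [measurable]: "(\<lambda>\<omega>. \<Sum>i\<in>I - insert j J. t i * Z i \<omega>) \<in> borel_measurable L"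
      by (rule borel_measurable_sum) (use that in auto)
    show ?thesis by measurable
  qed
  have bound: "cmod (?c Z \<omega>) \<le> 1" for Z :: "'i \<Rightarrow> 'c \<Rightarrow> real" and \<omega>
  proof -
    have "cmod (?c Z \<omega>) = (\<Prod>j\<in>J. cmod (indicator (B j) (Z j \<omega>)))"
      by (simp add: norm_mult prod_norm)
    also have "\<dots> \<le> 1"
      by (rule prod_le_1) (auto simp: indicator_def)
    finally show ?thesis .
  qed
  have split: "?c Z \<omega> * iexp (s * Z j \<omega>) =
      (\<Prod>j\<in>J. indicator (B j) (Z j \<omega>)) * iexp (\<Sum>i\<in>I - J. (t(j := s)) i * Z i \<omega>)"
    for Z :: "'i \<Rightarrow> 'c \<Rightarrow> real" and \<omega> s
  proof -
    have ins: "I - J = insert j (I - insert j J)" using j by auto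
    have "(\<Sum>i\<in>I - J. (t(j := s)) i * Z i \<omega>) = s * Z j \<omega> + (\<Sum>i\<in>I - insert j J. (t(j := s)) i * Z i \<omega>)"
      by (subst ins, subst sum.insert) (use I in auto)
    also have "(\<Sum>i\<in>I - insert j J. (t(j := s)) i * Z i \<omega>) = (\<Sum>i\<in>I - insert j J. t i * Z i \<omega>)"
      by (intro sum.cong) auto
    finally have "iexp (\<Sum>i\<in>I - J. (t(j := s)) i * Z i \<omega>) =
        iexp (s * Z j \<omega>) * iexp (\<Sum>i\<in>I - insert j J. t i * Z i \<omega>)"
      by (simp only: of_real_add distrib_left exp_add)
    then show ?thesis by (simp only: mult_ac)
  qed
  have marginal: "(\<Sum>i\<in>I. (if i = j then s else 0) * Z i \<omega>) = s * Z j \<omega>"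
    for Z :: "'i \<Rightarrow> 'c \<Rightarrow> real" and \<omega> s
  proof -
    have "(\<Sum>i\<in>I. (if i = j then s else 0) * Z i \<omega>) = (\<Sum>i\<in>I. if i = j then s * Z i \<omega> else 0)"
      by (intro sum.cong) auto
    then show ?thesis using j I by simp
  qed
  have "(\<integral>\<omega>. ?c X \<omega> * indicator (B j) (X j \<omega>) \<partial>M) = (\<integral>\<omega>. ?c Y \<omega> * indicator (B j) (Y j \<omega>) \<partial>N)"
  proof (rule complex_weighted_distr_eq_of_char_eq[OF M N])
    show "(\<integral>\<omega>. iexp (s * X j \<omega>) \<partial>M) = (\<integral>\<omega>. iexp (s * Y j \<omega>) \<partial>N)" for s
      using eq[of "\<lambda>i. if i = j then s else 0"] by (simp only: marginal)
    show "(\<integral>\<omega>. ?c X \<omega> * iexp (s * X j \<omega>) \<partial>M) = (\<integral>\<omega>. ?c Y \<omega> * iexp (s * Y j \<omega>) \<partial>N)" for s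
      using insert.IH[OF J, of "t(j := s)"] by (simp only: split)
  qed (use meas[OF X] meas[OF Y] bound X Y B j in auto)
  then show ?case
    using insert.hyps by (simp add: mult_ac)
qed

text \<open>
  Uniqueness theorem for joint characteristic functions: once all exponential factors have become
  indicators, the two laws agree on boxes.
\<close>
theorem joint_distr_eq_of_char_eq:
  fixes X :: "'i \<Rightarrow> 'a \<Rightarrow> real" and Y :: "'i \<Rightarrow> 'b \<Rightarrow> real"
  assumes M: "prob_space M" and N: "prob_space N" and I: "finite I"
    and X: "\<And>i. i \<in> I \<Longrightarrow> X i \<in> borel_measurable M"
    and Y: "\<And>i. i \<in> I \<Longrightarrow> Y i \<in> borel_measurable N"
    and eq: "\<And>t. (\<integral>\<omega>. iexp (\<Sum>i\<in>I. t i * X i \<omega>) \<partial>M) = (\<integral>\<omega>. iexp (\<Sum>i\<in>I. t i * Y i \<omega>) \<partial>N)"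
  shows "distr M (PiM I (\<lambda>_. borel)) (\<lambda>\<omega>. \<lambda>i\<in>I. X i \<omega>) = distr N (PiM I (\<lambda>_. borel)) (\<lambda>\<omega>. \<lambda>i\<in>I. Y i \<omega>)"
proof (rule measure_eqI_PiM_finite[OF I])
  have rv: "(\<lambda>\<omega>. \<lambda>i\<in>I. Z i \<omega>) \<in> measurable L (PiM I (\<lambda>_. borel))"
    if "\<And>i. i \<in> I \<Longrightarrow> Z i \<in> borel_measurable L" for Z :: "'i \<Rightarrow> 'c \<Rightarrow> real" and L
    using that by (intro measurable_restrict) auto
  interpret M: prob_space M by fact
  fix B :: "'i \<Rightarrow> real set" assume B: "\<And>i. i \<in> I \<Longrightarrow> B i \<in> sets borel"
  have box: "complex_of_real (measure (distr L (PiM I (\<lambda>_. borel)) (\<lambda>\<omega>. \<lambda>i\<in>I. Z i \<omega>)) (Pi\<^sub>E I B)) =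
      (\<integral>\<omega>. (\<Prod>j\<in>I. indicator (B j) (Z j \<omega>)) \<partial>L)"
    if L: "prob_space L" and Z: "\<And>i. i \<in> I \<Longrightarrow> Z i \<in> borel_measurable L"
    for Z :: "'i \<Rightarrow> 'c \<Rightarrow> real" and L
  proof -
    interpret L: prob_space L by fact
    have PB: "Pi\<^sub>E I B \<in> sets (PiM I (\<lambda>_. borel))" using B I by (intro sets_PiM_I_finite) auto
    let ?S = "(\<lambda>\<omega>. \<lambda>i\<in>I. Z i \<omega>) -` Pi\<^sub>E I B \<inter> space L"
    have S: "?S \<in> sets L" by (rule measurable_sets[OF rv[OF Z] PB])
    have "measure (distr L (PiM I (\<lambda>_. borel)) (\<lambda>\<omega>. \<lambda>i\<in>I. Z i \<omega>)) (Pi\<^sub>E I B) = measure L ?S"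
      by (rule measure_distr[OF rv[OF Z] PB])
    then have "complex_of_real (measure (distr L (PiM I (\<lambda>_. borel)) (\<lambda>\<omega>. \<lambda>i\<in>I. Z i \<omega>)) (Pi\<^sub>E I B))
        = complex_of_real (\<integral>\<omega>. indicator ?S \<omega> \<partial>L)"
      using S by simp
    also have "\<dots> = (\<integral>\<omega>. of_real (indicator ?S \<omega>) \<partial>L)"
      by simp
    also have "\<dots> = (\<integral>\<omega>. (\<Prod>j\<in>I. indicator (B j) (Z j \<omega>)) \<partial>L)"
    proof (rule Bochner_Integration.integral_cong[OF refl])
      fix \<omega> assume "\<omega> \<in> space L"
      then show "complex_of_real (indicator ?S \<omega>) = (\<Prod>j\<in>I. indicator (B j) (Z j \<omega>))"
        using I by (cases "\<forall>j\<in>I. Z j \<omega> \<in> B j") (auto simp: indicator_def PiE_iff prod_zero_iff)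
    qed
    finally show ?thesis .
  qed
  have "complex_of_real (measure (distr M (PiM I (\<lambda>_. borel)) (\<lambda>\<omega>. \<lambda>i\<in>I. X i \<omega>)) (Pi\<^sub>E I B)) =
      (\<integral>\<omega>. (\<Prod>j\<in>I. indicator (B j) (X j \<omega>)) \<partial>M)"
    by (rule box[OF M X])
  also have "\<dots> = (\<integral>\<omega>. (\<Prod>j\<in>I. indicator (B j) (Y j \<omega>)) \<partial>N)"
    using char_eq_imp_partial_box_eq[where t = "\<lambda>_. 0" and B = B, OF M N I X Y eq B I order_refl] by simp
  also have "\<dots> = of_real (measure (distr N (PiM I (\<lambda>_. borel)) (\<lambda>\<omega>. \<lambda>i\<in>I. Y i \<omega>)) (Pi\<^sub>E I B))"
    by (rule box[OF N Y, symmetric])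
  finally have "complex_of_real (measure (distr M (PiM I (\<lambda>_. borel)) (\<lambda>\<omega>. \<lambda>i\<in>I. X i \<omega>)) (Pi\<^sub>E I B)) =
      of_real (measure (distr N (PiM I (\<lambda>_. borel)) (\<lambda>\<omega>. \<lambda>i\<in>I. Y i \<omega>)) (Pi\<^sub>E I B))" .
  moreover have "finite_measure (distr M (PiM I (\<lambda>_. borel)) (\<lambda>\<omega>. \<lambda>i\<in>I. X i \<omega>))"
    by (rule prob_space.finite_measure[OF prob_space.prob_space_distr[OF M rv[OF X]]])
  moreover have "finite_measure (distr N (PiM I (\<lambda>_. borel)) (\<lambda>\<omega>. \<lambda>i\<in>I. Y i \<omega>))"
    by (rule prob_space.finite_measure[OF prob_space.prob_space_distr[OF N rv[OF Y]]])
  ultimately show "emeasure (distr M (PiM I (\<lambda>_. borel)) (\<lambda>\<omega>. \<lambda>i\<in>I. X i \<omega>)) (Pi\<^sub>E I B) =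
      emeasure (distr N (PiM I (\<lambda>_. borel)) (\<lambda>\<omega>. \<lambda>i\<in>I. Y i \<omega>)) (Pi\<^sub>E I B)"
    by (simp only: finite_measure.emeasure_eq_measure of_real_eq_iff)
next
  show "range (\<lambda>_::nat. space (PiM I (\<lambda>_. borel))) \<subseteq> prod_algebra I (\<lambda>_. borel :: real measure)"
    using I by (auto simp: space_PiM intro!: prod_algebraI_finite)
  show "(\<Union>i::nat. space (PiM I (\<lambda>_. borel :: real measure))) = space (PiM I (\<lambda>_. borel))" by simp
  fix i :: nat
  have "prob_space (distr M (PiM I (\<lambda>_. borel)) (\<lambda>\<omega>. \<lambda>i\<in>I. X i \<omega>))"
    using X by (intro prob_space.prob_space_distr[OF M] measurable_restrict) auto
  then interpret D: prob_space "distr M (PiM I (\<lambda>_. borel)) (\<lambda>\<omega>. \<lambda>i\<in>I. X i \<omega>)" .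
  show "emeasure (distr M (PiM I (\<lambda>_. borel)) (\<lambda>\<omega>. \<lambda>i\<in>I. X i \<omega>)) (space (PiM I (\<lambda>_. borel))) \<noteq> \<infinity>"
    by (simp add: D.emeasure_eq_measure)
qed auto

text \<open>
  The complex form of the uniqueness theorem, with real and imaginary parts as separate
  coordinates. A complex frequency \<open>w p\<close> encodes the pair of real frequencies, since
  \<open>Re (w * z) = Re w * Re z - Im w * Im z\<close>.
\<close>
lemma expectation_array_eq_of_char_eq:
  fixes X :: "'i::countable \<Rightarrow> 'a \<Rightarrow> complex" and Y :: "'i \<Rightarrow> 'b \<Rightarrow> complex"
  assumes M: "prob_space M" and N: "prob_space N" and P: "finite P"
    and X: "\<And>p. p \<in> P \<Longrightarrow> X p \<in> borel_measurable M"
    and Y: "\<And>p. p \<in> P \<Longrightarrow> Y p \<in> borel_measurable N"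
    and eq: "\<And>w. (\<integral>\<omega>. iexp (\<Sum>p\<in>P. Re (w p * X p \<omega>)) \<partial>M) = (\<integral>\<omega>. iexp (\<Sum>p\<in>P. Re (w p * Y p \<omega>)) \<partial>N)"
    and h: "array_test_function P h"
  shows "(\<integral>\<omega>. h (\<lambda>p. X p \<omega>) \<partial>M) = (\<integral>\<omega>. h (\<lambda>p. Y p \<omega>) \<partial>N)"
proof -
  let ?I = "P \<times> (UNIV :: bool set)"
  define part where "part i z = (if snd i then Im z else Re z)" for i :: "'i \<times> bool" and z
  define glue where "glue x p = (if p \<in> P then Complex (x (p, False)) (x (p, True)) else 0)" for x and p :: 'i
  have I: "finite ?I" using P by simp
  have meas: "(\<lambda>\<omega>. part i (Z (fst i) \<omega>)) \<in> borel_measurable L"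
    if Z: "\<And>p. p \<in> P \<Longrightarrow> Z p \<in> borel_measurable L" and pb: "i \<in> ?I" for Z :: "'i \<Rightarrow> 'c \<Rightarrow> complex" and L i
  proof -
    obtain p b where i: "i = (p, b)" "p \<in> P" using pb by auto
    then have [measurable]: "Z p \<in> borel_measurable L" using Z by auto
    show ?thesis unfolding i part_def by (cases b) auto
  qed
  have sum: "(\<Sum>i\<in>?I. t i * part i (Z (fst i) \<omega>)) = (\<Sum>p\<in>P. Re (Complex (t (p, False)) (- t (p, True)) * Z p \<omega>))"
    for t and Z :: "'i \<Rightarrow> 'c \<Rightarrow> complex" and \<omega>
  proof -
    have "(\<Sum>i\<in>?I. t i * part i (Z (fst i) \<omega>)) =
        (\<Sum>p\<in>P. \<Sum>b\<in>UNIV. t (p, b) * part (p, b) (Z p \<omega>))"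
      unfolding sum.cartesian_product by (intro sum.cong) auto
    then show ?thesis by (simp add: UNIV_bool part_def)
  qed
  have law: "distr M (PiM ?I (\<lambda>_. borel)) (\<lambda>\<omega>. \<lambda>i\<in>?I. part i (X (fst i) \<omega>)) = distr N (PiM ?I (\<lambda>_. borel)) (\<lambda>\<omega>. \<lambda>i\<in>?I. part i (Y (fst i) \<omega>))"
  proof (rule joint_distr_eq_of_char_eq[OF M N I])
    show "(\<integral>\<omega>. iexp (\<Sum>i\<in>?I. t i * part i (X (fst i) \<omega>)) \<partial>M) = (\<integral>\<omega>. iexp (\<Sum>i\<in>?I. t i * part i (Y (fst i) \<omega>)) \<partial>N)" for t
      unfolding sum by (rule eq)
  qed (use meas[OF X] meas[OF Y] in auto)
  have hm: "(\<lambda>x. h (glue x)) \<in> borel_measurable (PiM ?I (\<lambda>_. borel))"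
  proof (rule array_test_function_measurable[OF h])
    fix p assume p: "p \<in> P"
    then have [measurable]: "(\<lambda>x. x (p, b)) \<in> borel_measurable (PiM ?I (\<lambda>_. borel :: real measure))" for b
      by (intro measurable_component_singleton) auto
    have "(\<lambda>x. Complex (x (p, False)) (x (p, True))) \<in> borel_measurable (PiM ?I (\<lambda>_. borel))"
      unfolding Complex_eq by measurable
    then show "(\<lambda>x. glue x p) \<in> borel_measurable (PiM ?I (\<lambda>_. borel))"
      using p by (simp add: glue_def)
  qed
  have transfer: "(\<integral>\<omega>. h (\<lambda>p. Z p \<omega>) \<partial>L) = (\<integral>x. h (glue x) \<partial>distr L (PiM ?I (\<lambda>_. borel)) (\<lambda>\<omega>. \<lambda>i\<in>?I. part i (Z (fst i) \<omega>)))"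
    if "\<And>p. p \<in> P \<Longrightarrow> Z p \<in> borel_measurable L" for Z :: "'i \<Rightarrow> 'c \<Rightarrow> complex" and L
  proof -
    have "(\<integral>x. h (glue x) \<partial>distr L (PiM ?I (\<lambda>_. borel)) (\<lambda>\<omega>. \<lambda>i\<in>?I. part i (Z (fst i) \<omega>))) =
        (\<integral>\<omega>. h (glue (\<lambda>i\<in>?I. part i (Z (fst i) \<omega>))) \<partial>L)"
      by (rule integral_distr[OF _ hm]) (intro measurable_restrict meas that)
    also have "\<dots> = (\<integral>\<omega>. h (\<lambda>p. Z p \<omega>) \<partial>L)"
      by (intro Bochner_Integration.integral_cong[OF refl] array_test_function_cong[OF h])
         (auto simp: glue_def part_def)
    finally show ?thesis ..
  qed
  show ?thesis using transfer[OF X] transfer[OF Y] law by simp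
qed

section \<open>Nearly orthonormal families and unitary matrices\<close>

text \<open>
  Vectors in $\mathbb C^n$ are functions of which only the first \<^term>\<open>n\<close> values count; this
  allows the dimension to vary.
\<close>
definition cinner :: "nat \<Rightarrow> (nat \<Rightarrow> complex) \<Rightarrow> (nat \<Rightarrow> complex) \<Rightarrow> complex" where
  "cinner n u v = (\<Sum>a<n. u a * cnj (v a))"

definition cnorm :: "nat \<Rightarrow> (nat \<Rightarrow> complex) \<Rightarrow> real" where
  "cnorm n u = L2_set (\<lambda>a. cmod (u a)) {..<n}"

definition orthonormal_on :: "nat \<Rightarrow> nat set \<Rightarrow> (nat \<Rightarrow> nat \<Rightarrow> complex) \<Rightarrow> bool" where
  "orthonormal_on n S q \<longleftrightarrow> (\<forall>i\<in>S. \<forall>j\<in>S. cinner n (q i) (q j) = of_bool (i = j))"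

lemma cnorm_nonneg: "0 \<le> cnorm n u"
  by (simp add: cnorm_def)

lemma cnorm_sq: "(cnorm n u)\<^sup>2 = (\<Sum>a<n. (cmod (u a))\<^sup>2)"
  by (simp add: cnorm_def L2_set_def sum_nonneg)

lemma cinner_self: "cinner n u u = of_real ((cnorm n u)\<^sup>2)"
  unfolding cinner_def cnorm_sq of_real_sum by (intro sum.cong refl) (simp flip: complex_norm_square)

lemma cnorm_triangle: "cnorm n (\<lambda>a. u a + v a) \<le> cnorm n u + cnorm n v"
proof -
  have "cnorm n (\<lambda>a. u a + v a) \<le> L2_set (\<lambda>a. cmod (u a) + cmod (v a)) {..<n}"
    unfolding cnorm_def by (intro L2_set_mono norm_triangle_ineq) auto
  also have "\<dots> \<le> cnorm n u + cnorm n v"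
    unfolding cnorm_def by (rule L2_set_triangle_ineq)
  finally show ?thesis .
qed

lemma cnorm_scale: "cnorm n (\<lambda>a. c * u a) = cmod c * cnorm n u"
  by (simp add: cnorm_def norm_mult L2_set_right_distrib)

lemma cnorm_diff_triangle: "cnorm n (\<lambda>a. u a - w a) \<le> cnorm n (\<lambda>a. u a - v a) + cnorm n (\<lambda>a. v a - w a)"
  using cnorm_triangle[of n "\<lambda>a. u a - v a" "\<lambda>a. v a - w a"] by simp

lemma cnorm_diff_commute: "cnorm n (\<lambda>a. u a - v a) = cnorm n (\<lambda>a. v a - u a)"
  by (simp add: cnorm_def norm_minus_commute)

lemma abs_cnorm_diff_le: "\<bar>cnorm n u - cnorm n v\<bar> \<le> cnorm n (\<lambda>a. u a - v a)"
  using cnorm_triangle[of n "\<lambda>a. u a - v a" v] cnorm_triangle[of n "\<lambda>a. v a - u a" u]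
    cnorm_diff_commute[of n u v] by simp

lemma cnorm_sum_le: "finite I \<Longrightarrow> cnorm n (\<lambda>a. \<Sum>i\<in>I. u i a) \<le> (\<Sum>i\<in>I. cnorm n (u i))"
proof (induction I rule: finite_induct)
  case empty
  show ?case by (simp add: cnorm_def L2_set_def)
next
  case (insert i I)
  then show ?case
    using cnorm_triangle[of n "u i" "\<lambda>a. \<Sum>i\<in>I. u i a"] by simp
qed

lemma cinner_Cauchy_Schwarz: "cmod (cinner n u v) \<le> cnorm n u * cnorm n v"
proof -
  have "cmod (cinner n u v) \<le> (\<Sum>a<n. \<bar>cmod (u a)\<bar> * \<bar>cmod (v a)\<bar>)"
    unfolding cinner_def by (rule order_trans[OF norm_sum]) (simp add: norm_mult)
  also have "\<dots> \<le> cnorm n u * cnorm n v"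
    unfolding cnorm_def by (rule L2_set_mult_ineq)
  finally show ?thesis .
qed

lemma cinner_diff_left: "cinner n (\<lambda>a. u a - v a) w = cinner n u w - cinner n v w"
  by (simp add: cinner_def left_diff_distrib sum_subtractf)

lemma cinner_diff_right: "cinner n u (\<lambda>a. v a - w a) = cinner n u v - cinner n u w"
  by (simp add: cinner_def right_diff_distrib sum_subtractf)

lemma cinner_scale_left: "cinner n (\<lambda>a. c * u a) v = c * cinner n u v"
  by (simp add: cinner_def sum_distrib_left mult.assoc)

lemma cinner_scale_right: "cinner n u (\<lambda>a. c * v a) = cnj c * cinner n u v"
  by (simp add: cinner_def sum_distrib_left mult_ac)

lemma cinner_sum_left: "cinner n (\<lambda>a. \<Sum>i\<in>I. u i a) v = (\<Sum>i\<in>I. cinner n (u i) v)"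
  unfolding cinner_def sum_distrib_right by (rule sum.swap)

lemma cinner_commute: "cinner n v u = cnj (cinner n u v)"
  by (simp add: cinner_def mult.commute)

lemma orthonormal_on_insert_normalized:
  assumes q: "orthonormal_on n S q" and r: "r \<notin> S"
    and v0: "cnorm n v > 0" and vq: "\<And>i. i \<in> S \<Longrightarrow> cinner n v (q i) = 0"
  shows "orthonormal_on n (insert r S) (q(r := \<lambda>a. of_real (1 / cnorm n v) * v a))"
  unfolding orthonormal_on_def
proof (intro ballI)
  fix i j assume ij: "i \<in> insert r S" "j \<in> insert r S"
  let ?u = "\<lambda>a. of_real (1 / cnorm n v) * v a"
  have uu: "cinner n ?u ?u = 1"
    unfolding cinner_scale_left cinner_scale_right cinner_self
    using v0 by (simp add: power2_eq_square)
  have uq: "cinner n ?u (q i) = 0" if "i \<in> S" for i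
    unfolding cinner_scale_left using vq[OF that] by simp
  then have qu: "cinner n (q i) ?u = 0" if "i \<in> S" for i
    using cinner_commute[of n "q i" ?u] that by simp
  show "cinner n ((q(r := ?u)) i) ((q(r := ?u)) j) = of_bool (i = j)"
  proof (cases "i = r"; cases "j = r")
    assume "i \<noteq> r" "j \<noteq> r"
    then show ?thesis using ij q by (simp add: orthonormal_on_def)
  qed (use ij r uu uq qu in auto)
qed

text \<open>
  The Gram-Schmidt process is stable: applied to a nearly orthonormal family it moves each vector
  only a little. What matters is that \<open>\<delta>\<close> depends on the number \<^term>\<open>k\<close> of vectors
  and on \<^term>\<open>\<eta>\<close>, but not on the dimension.
\<close>
lemma near_orthonormal_close_to_orthonormal:
  fixes k :: nat and \<eta> :: real
  assumes "\<eta> > 0"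
  shows "\<exists>\<delta>>0. \<forall>n w. (\<forall>i<k. \<forall>j<k. cmod (cinner n (w i) (w j) - of_bool (i = j)) \<le> \<delta>) \<longrightarrow>
    (\<exists>q. orthonormal_on n {..<k} q \<and> (\<forall>i<k. cnorm n (\<lambda>a. w i a - q i a) \<le> \<eta>))"
  using assms
proof (induction k arbitrary: \<eta>)
  case 0
  show ?case by (intro exI[of _ 1]) (simp add: orthonormal_on_def)
next
  case (Suc k)
  \<comment> \<open>Error budget: the projections onto the first \<open>k\<close> vectors move the new vector by at most
    \<open>3 * e * k\<close>, hence by less than \<open>3/8\<close> of \<open>\<eta>0\<close>; its norm then differs from one by at most half of
    \<open>\<eta>0\<close>, and normalising it moves it by that much again.\<close>
  define \<eta>0 where "\<eta>0 = min \<eta> 1"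
  define e where "e = \<eta>0 / (8 * (real k + 1))"
  have e: "e > 0" "e * (real k + 1) = \<eta>0 / 8" "0 < \<eta>0" "\<eta>0 \<le> 1" "\<eta>0 \<le> \<eta>"
    using Suc.prems by (auto simp: e_def \<eta>0_def field_simps)
  have e8: "e \<le> \<eta>0 / 8"
  proof -
    have "e * 1 \<le> e * (real k + 1)" using e(1) by (intro mult_left_mono) auto
    then show ?thesis using e(2) by simp
  qed
  from Suc.IH[OF e(1)] obtain \<delta>' where \<delta>': "\<delta>' > 0"
    "\<forall>n w. (\<forall>i<k. \<forall>j<k. cmod (cinner n (w i) (w j) - of_bool (i = j)) \<le> \<delta>') \<longrightarrow>
      (\<exists>q. orthonormal_on n {..<k} q \<and> (\<forall>i<k. cnorm n (\<lambda>a. w i a - q i a) \<le> e))"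
    by (elim exE conjE)
  show ?case
  proof (intro exI[of _ "min \<delta>' e"] conjI allI impI)
    show "0 < min \<delta>' e" using \<delta>'(1) e(1) by simp
    fix n w assume w: "\<forall>i<Suc k. \<forall>j<Suc k. cmod (cinner n (w i) (w j) - of_bool (i = j)) \<le> min \<delta>' e"
    have "\<exists>q. orthonormal_on n {..<k} q \<and> (\<forall>i<k. cnorm n (\<lambda>a. w i a - q i a) \<le> e)"
      by (rule \<delta>'(2)[rule_format]) (use w in auto)
    then obtain q where q: "orthonormal_on n {..<k} q" and wq: "\<And>i. i < k \<Longrightarrow> cnorm n (\<lambda>a. w i a - q i a) \<le> e"
      by auto
    \<comment> \<open>the new vector is already almost of norm one ...\<close>
    have "\<bar>(cnorm n (w k))\<^sup>2 - 1\<bar> \<le> e"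
    proof -
      have "cmod (cinner n (w k) (w k) - 1) \<le> e" using w[rule_format, of k k] by simp
      moreover have "cinner n (w k) (w k) - 1 = of_real ((cnorm n (w k))\<^sup>2 - 1)"
        by (simp add: cinner_self)
      ultimately show ?thesis by (simp only: norm_of_real)
    qed
    moreover have "\<bar>(cnorm n (w k))\<^sup>2 - 1\<bar> = \<bar>cnorm n (w k) - 1\<bar> * (cnorm n (w k) + 1)"
      using cnorm_nonneg[of n "w k"] by (simp add: power2_eq_square square_diff_one_factored abs_mult)
    moreover have "\<bar>cnorm n (w k) - 1\<bar> * 1 \<le> \<bar>cnorm n (w k) - 1\<bar> * (cnorm n (w k) + 1)"
      using cnorm_nonneg[of n "w k"] by (intro mult_left_mono) auto
    ultimately have wk: "\<bar>cnorm n (w k) - 1\<bar> \<le> e"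
      unfolding mult_1_right by (metis order_trans)
    have wk2: "cnorm n (w k) \<le> 2" using wk e8 e(3,4) by linarith
    \<comment> \<open>... and almost orthogonal to the vectors found so far\<close>
    define c where "c i = cinner n (w k) (q i)" for i
    have c: "cmod (c i) \<le> 3 * e" if "i < k" for i
    proof -
      have "c i = cinner n (w k) (w i) - cinner n (w k) (\<lambda>a. w i a - q i a)"
        by (simp add: c_def cinner_diff_right)
      also have "cmod \<dots> \<le> cmod (cinner n (w k) (w i)) + cmod (cinner n (w k) (\<lambda>a. w i a - q i a))"
        by (rule norm_triangle_ineq4)
      also have "cmod (cinner n (w k) (w i)) \<le> e"
        using w[rule_format, of k i] that by simp
      also have "cmod (cinner n (w k) (\<lambda>a. w i a - q i a)) \<le> 2 * e"
        by (rule order_trans[OF cinner_Cauchy_Schwarz mult_mono[OF wk2 wq[OF that]]])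
           (auto simp: cnorm_nonneg)
      finally show ?thesis by simp
    qed
    define v where "v a = w k a - (\<Sum>i<k. c i * q i a)" for a
    have qn: "cnorm n (q i) = 1" if "i < k" for i
    proof -
      have "complex_of_real ((cnorm n (q i))\<^sup>2) = 1"
        using q that unfolding cinner_self[symmetric] orthonormal_on_def by simp
      then have "(cnorm n (q i))\<^sup>2 = 1" by (simp only: of_real_eq_1_iff)
      then show ?thesis using cnorm_nonneg[of n "q i"] by (simp add: power2_eq_1_iff)
    qed
    have "cnorm n (\<lambda>a. w k a - v a) = cnorm n (\<lambda>a. \<Sum>i<k. c i * q i a)"
      by (simp add: v_def)
    also have "\<dots> \<le> (\<Sum>i<k. cmod (c i) * cnorm n (q i))"
      by (rule order_trans[OF cnorm_sum_le]) (simp_all add: cnorm_scale)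
    also have "\<dots> \<le> (\<Sum>i<k. 3 * e)"
      by (rule sum_mono) (use c qn in auto)
    also have "\<dots> \<le> 3 * (e * (real k + 1))" using e(1) by (simp add: algebra_simps)
    finally have vw: "cnorm n (\<lambda>a. w k a - v a) \<le> 3 * \<eta>0 / 8" using e(2) by simp
    have v1: "\<bar>cnorm n v - 1\<bar> \<le> \<eta>0 / 2"
      using abs_cnorm_diff_le[of n "w k" v] vw wk e8 by linarith
    then have v0: "cnorm n v > 0" using e(3,4) by linarith
    have vq: "cinner n v (q j) = 0" if "j \<in> {..<k}" for j
    proof -
      have "cinner n v (q j) = c j - (\<Sum>i<k. c i * cinner n (q i) (q j))"
        unfolding v_def cinner_diff_left cinner_sum_left cinner_scale_left c_def ..
      also have "(\<Sum>i<k. c i * cinner n (q i) (q j)) = (\<Sum>i<k. if i = j then c j else 0)"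
        by (rule sum.cong) (use q that in \<open>auto simp: orthonormal_on_def\<close>)
      also have "\<dots> = c j" using that by simp
      finally show ?thesis by simp
    qed
    let ?u = "\<lambda>a. of_real (1 / cnorm n v) * v a"
    have "cnorm n (\<lambda>a. v a - ?u a) = \<bar>cnorm n v - 1\<bar>"
    proof -
      have "(\<lambda>a. v a - ?u a) = (\<lambda>a. of_real (1 - 1 / cnorm n v) * v a)"
        by (simp add: fun_eq_iff algebra_simps)
      then have "cnorm n (\<lambda>a. v a - ?u a) = \<bar>1 - 1 / cnorm n v\<bar> * cnorm n v"
        by (simp only: cnorm_scale norm_of_real)
      also have "\<dots> = \<bar>(1 - 1 / cnorm n v) * cnorm n v\<bar>" using v0 by (simp add: abs_mult)
      also have "(1 - 1 / cnorm n v) * cnorm n v = cnorm n v - 1" using v0 by (simp add: field_simps)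
      finally show ?thesis .
    qed
    then have "cnorm n (\<lambda>a. w k a - ?u a) \<le> \<eta>"
      using cnorm_diff_triangle[of n "w k" ?u v] vw v1 e(3,5) by linarith
    moreover have "orthonormal_on n {..<Suc k} (q(k := ?u))"
      unfolding lessThan_Suc by (rule orthonormal_on_insert_normalized[OF q _ v0 vq]) auto
    moreover have "cnorm n (\<lambda>a. w i a - q i a) \<le> \<eta>" if "i < k" for i
      using wq[OF that] e8 e(3,5) by linarith
    ultimately show "\<exists>q. orthonormal_on n {..<Suc k} q \<and> (\<forall>i<Suc k. cnorm n (\<lambda>a. w i a - q i a) \<le> \<eta>)"
      by (intro exI[of _ "q(k := ?u)"]) (auto simp: less_Suc_eq)
  qed
qed

text \<open>
  A square homogeneous system in which one equation is trivial has a nonzero solution.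
\<close>
lemma exists_orthogonal_vector:
  assumes "r < n" "r \<notin> S"
  shows "\<exists>v. cnorm n v > 0 \<and> (\<forall>i\<in>S. i < n \<longrightarrow> cinner n v (q i) = 0)"
proof -
  let ?A = "mat n n (\<lambda>(i, a). if i \<in> S then cnj (q i a) else 0)"
  have A: "?A \<in> carrier_mat n n" by simp
  have "det (mat\<^sub>r n n (\<lambda>i. if i = r then 0\<^sub>v n else row ?A i)) = 0"
    by (rule det_row_0) (use assms in auto)
  moreover have "mat\<^sub>r n n (\<lambda>i. if i = r then 0\<^sub>v n else row ?A i) = ?A"
    by (rule eq_matI) (use assms in auto)
  ultimately have "det ?A = 0" by simp
  then obtain v where v: "v \<in> carrier_vec n" "v \<noteq> 0\<^sub>v n" "?A *\<^sub>v v = 0\<^sub>v n"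
    using det_0_iff_vec_prod_zero[OF A] by blast
  have orth: "cinner n (\<lambda>a. v $ a) (q i) = 0" if "i \<in> S" "i < n" for i
  proof -
    have "0 = (?A *\<^sub>v v) $ i" using v(3) that by simp
    also have "\<dots> = (\<Sum>a<n. cnj (q i a) * v $ a)"
      using that v(1) by (simp add: scalar_prod_def lessThan_atLeast0)
    finally show ?thesis by (simp add: cinner_def mult.commute)
  qed
  obtain a where "a < n" "v $ a \<noteq> 0"
    using v(1,2) by (metis carrier_vecD eq_vecI index_zero_vec)
  then have "(\<Sum>a<n. (cmod (v $ a))\<^sup>2) > 0"
    by (intro sum_pos2[of _ a]) auto
  then have "cnorm n (\<lambda>a. v $ a) > 0"
    using cnorm_sq[of n "\<lambda>a. v $ a"] cnorm_nonneg[of n "\<lambda>a. v $ a"] by (simp add: less_le) force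
  with orth show ?thesis by blast
qed

text \<open>
  An orthonormal family indexed by some of the rows extends to an orthonormal basis, every
  given vector keeping its row.
\<close>
lemma orthonormal_extension:
  assumes "S \<subseteq> {..<n}" "orthonormal_on n S q"
  shows "\<exists>q'. (\<forall>i\<in>S. q' i = q i) \<and> orthonormal_on n {..<n} q'"
  using assms
proof (induction "card ({..<n} - S)" arbitrary: S q)
  case 0
  then have "S = {..<n}" by auto
  then show ?case using 0 by blast
next
  case (Suc m)
  then obtain r where r: "r \<in> {..<n} - S" by (metis card.empty equals0I nat.distinct(1))
  obtain v where v: "cnorm n v > 0" "\<And>i. i \<in> S \<Longrightarrow> cinner n v (q i) = 0"
    using exists_orthogonal_vector[of r n S q] r Suc.prems(1) by auto
  let ?q = "q(r := \<lambda>a. of_real (1 / cnorm n v) * v a)"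
  have "orthonormal_on n (insert r S) ?q"
    by (rule orthonormal_on_insert_normalized[OF Suc.prems(2) _ v]) (use r in auto)
  moreover have "m = card ({..<n} - insert r S)"
    using Suc.hyps(2) r by (simp add: card_Diff_insert)
  ultimately obtain q' where "\<forall>i\<in>insert r S. q' i = ?q i" "orthonormal_on n {..<n} q'"
    using Suc.hyps(1)[of "insert r S" ?q] Suc.prems(1) r by auto
  then show ?case using r by (intro exI[of _ q']) auto
qed

lemma mat_adjoint_index:
  assumes "A \<in> carrier_mat n n" "i < n" "j < n"
  shows "mat_adjoint A $$ (i, j) = cnj (A $$ (j, i))"
  using assms by (simp add: mat_adjoint_def mat_of_rows_index)

lemma mat_adjoint_carrier: "A \<in> carrier_mat n n \<Longrightarrow> mat_adjoint A \<in> carrier_mat n n"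
  by (auto simp: mat_adjoint_def mat_of_rows_def)

lemma mult_mat_index:
  assumes "A \<in> carrier_mat n n" "B \<in> carrier_mat n n" "i < n" "j < n"
  shows "(A * B) $$ (i, j) = (\<Sum>a<n. A $$ (i, a) * B $$ (a, j))"
  using assms by (auto simp: scalar_prod_def lessThan_atLeast0 intro!: sum.cong)

lemma unitary_of_orthonormal_rows:
  assumes "orthonormal_on n {..<n} q"
  shows "mat n n (\<lambda>(i, a). q i a) \<in> unitary_group n"
proof -
  let ?A = "mat n n (\<lambda>(i, a). q i a)"
  have A: "?A \<in> carrier_mat n n" by simp
  note A' = mat_adjoint_carrier[OF A]
  have "?A * mat_adjoint ?A = 1\<^sub>m n"
  proof (rule eq_matI)
    fix i j assume "i < dim_row (1\<^sub>m n :: complex mat)" "j < dim_col (1\<^sub>m n :: complex mat)"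
    then have ij: "i < n" "j < n" by auto
    have "(?A * mat_adjoint ?A) $$ (i, j) = (\<Sum>a<n. ?A $$ (i, a) * mat_adjoint ?A $$ (a, j))"
      by (rule mult_mat_index[OF A A' ij])
    also have "\<dots> = cinner n (q i) (q j)"
      unfolding cinner_def by (rule sum.cong) (use ij in \<open>auto simp: mat_adjoint_index[OF A]\<close>)
    also have "\<dots> = 1\<^sub>m n $$ (i, j)" using assms ij by (auto simp: orthonormal_on_def)
    finally show "(?A * mat_adjoint ?A) $$ (i, j) = 1\<^sub>m n $$ (i, j)" .
  qed (use A' in auto)
  then show ?thesis
    using mat_mult_left_right_inverse[OF A A'] A by (simp add: unitary_group_def)
qed

lemma unitary_columns_orthonormal:
  assumes A: "A \<in> unitary_group n" and "c < n" "c' < n"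
  shows "(\<Sum>a<n. A $$ (a, c) * cnj (A $$ (a, c'))) = of_bool (c = c')"
proof -
  have Ac: "A \<in> carrier_mat n n" and AA: "mat_adjoint A * A = 1\<^sub>m n"
    using A by (auto simp: unitary_group_def)
  have "(mat_adjoint A * A) $$ (c', c) = (\<Sum>a<n. mat_adjoint A $$ (c', a) * A $$ (a, c))"
    by (rule mult_mat_index[OF mat_adjoint_carrier[OF Ac] Ac assms(3,2)])
  also have "\<dots> = (\<Sum>a<n. A $$ (a, c) * cnj (A $$ (a, c')))"
    by (rule sum.cong) (use assms in \<open>auto simp: mat_adjoint_index[OF Ac]\<close>)
  finally show ?thesis using AA assms by auto
qed

lemma unitary_adjoint: "A \<in> unitary_group n \<Longrightarrow> mat_adjoint A \<in> unitary_group n"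
proof -
  assume A: "A \<in> unitary_group n"
  then have Ac: "A \<in> carrier_mat n n" by (simp add: unitary_group_def)
  note A' = mat_adjoint_carrier[OF Ac]
  have "mat_adjoint (mat_adjoint A) = A"
    by (rule eq_matI)
       (use Ac A' mat_adjoint_carrier[OF A'] in \<open>auto simp: mat_adjoint_index[OF Ac] mat_adjoint_index[OF A']\<close>)
  then show ?thesis using A A' by (simp add: unitary_group_def)
qed

section \<open>Haar distributed unitary matrices\<close>

lemma topspace_unitary_topology: "topspace (unitary_topology n) = unitary_group n"
  by (auto simp: unitary_topology_def topspace_mat_topology unitary_group_def)

lemma continuous_map_unitary_entry:
  "i < n \<Longrightarrow> j < n \<Longrightarrow> continuous_map (unitary_topology n) euclidean (\<lambda>A. A $$ (i, j))"
  unfolding unitary_topology_def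
  by (intro continuous_map_from_subtopology continuous_map_mat_entry)

lemma unitary_mult_closed:
  assumes A: "A \<in> unitary_group n" and B: "B \<in> unitary_group n"
  shows "A * B \<in> unitary_group n"
proof -
  have c: "A \<in> carrier_mat n n" "B \<in> carrier_mat n n"
    using A B by (auto simp: unitary_group_def)
  note a = c[THEN mat_adjoint_carrier]
  have AB: "A * B \<in> carrier_mat n n" using c by simp
  have adj: "mat_adjoint (A * B) = mat_adjoint B * mat_adjoint A"
  proof (rule eq_matI)
    fix i j assume "i < dim_row (mat_adjoint B * mat_adjoint A)" "j < dim_col (mat_adjoint B * mat_adjoint A)"
    then have ij: "i < n" "j < n" using a by auto
    have "mat_adjoint (A * B) $$ (i, j) = (\<Sum>l<n. cnj (A $$ (j, l)) * cnj (B $$ (l, i)))"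
      by (simp only: mat_adjoint_index[OF AB ij] mult_mat_index[OF c ij(2,1)] cnj_sum complex_cnj_mult)
    also have "\<dots> = (mat_adjoint B * mat_adjoint A) $$ (i, j)"
      unfolding mult_mat_index[OF a(2,1) ij]
      by (rule sum.cong) (use ij in \<open>auto simp: mat_adjoint_index[OF c(1)] mat_adjoint_index[OF c(2)]\<close>)
    finally show "mat_adjoint (A * B) $$ (i, j) = (mat_adjoint B * mat_adjoint A) $$ (i, j)" .
  qed (use a mat_adjoint_carrier[OF AB] in auto)
  have "A * B * (mat_adjoint B * mat_adjoint A) = A * (B * mat_adjoint B) * mat_adjoint A"
    using c a by (simp add: assoc_mult_mat[of _ n n _ n _ n])
  also have "\<dots> = 1\<^sub>m n" using A B c a by (simp add: unitary_group_def)
  finally have "A * B * mat_adjoint (A * B) = 1\<^sub>m n" by (simp only: adj)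
  then show ?thesis
    using mat_mult_left_right_inverse[OF AB mat_adjoint_carrier[OF AB]] AB by (simp add: unitary_group_def)
qed

lemma continuous_map_unitary_left_mult:
  assumes A: "A \<in> unitary_group n"
  shows "continuous_map (unitary_topology n) (unitary_topology n) (\<lambda>B. A * B)"
proof -
  have "continuous_map (unitary_topology n) (mat_topology n n) (\<lambda>B. A * B)"
  proof (rule continuous_map_into_mat_topology)
    fix B assume "B \<in> topspace (unitary_topology n)"
    then show "A * B \<in> carrier_mat n n"
      using unitary_mult_closed[OF A] by (auto simp: topspace_unitary_topology unitary_group_def)
  next
    fix i j assume ij: "i < n" "j < n"
    have "continuous_map (unitary_topology n) euclidean (\<lambda>B. \<Sum>a<n. A $$ (i, a) * B $$ (a, j))"
    proof (rule continuous_map_sum)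
      fix a assume "a \<in> {..<n}"
      then have "continuous_map (unitary_topology n) euclidean (\<lambda>B. B $$ (a, j))"
        by (intro continuous_map_unitary_entry ij) auto
      moreover have "continuous_map euclidean euclidean (\<lambda>z. A $$ (i, a) * z)"
        by (simp add: continuous_intros)
      ultimately have "continuous_map (unitary_topology n) euclidean
          ((\<lambda>z. A $$ (i, a) * z) \<circ> (\<lambda>B. B $$ (a, j)))"
        by (rule continuous_map_compose)
      then show "continuous_map (unitary_topology n) euclidean (\<lambda>B. A $$ (i, a) * B $$ (a, j))"
        by (simp only: comp_def)
    qed simp
    then show "continuous_map (unitary_topology n) euclidean (\<lambda>B. (A * B) $$ (i, j))"
    proof (rule continuous_map_eq)
      fix B assume "B \<in> topspace (unitary_topology n)"
      then have "B \<in> carrier_mat n n" by (simp add: topspace_unitary_topology unitary_group_def)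
      then show "(\<Sum>a<n. A $$ (i, a) * B $$ (a, j)) = (A * B) $$ (i, j)"
        using A by (subst mult_mat_index[OF _ _ ij]) (auto simp: unitary_group_def)
    qed
  qed
  then show ?thesis
    using unitary_mult_closed[OF A]
    unfolding unitary_topology_def continuous_map_in_subtopology
    by (auto simp: topspace_mat_topology)
qed

lemma unitary_left_cancel:
  assumes A: "A \<in> unitary_group n" and B: "B \<in> unitary_group n"
  shows "mat_adjoint A * (A * B) = B" "A * (mat_adjoint A * B) = B"
proof -
  have c: "A \<in> carrier_mat n n" "B \<in> carrier_mat n n" "mat_adjoint A \<in> carrier_mat n n"
    using A B mat_adjoint_carrier by (auto simp: unitary_group_def)
  have "mat_adjoint A * (A * B) = mat_adjoint A * A * B"
    by (rule assoc_mult_mat[OF c(3,1,2), symmetric])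
  also have "\<dots> = B" using A c by (simp add: unitary_group_def)
  finally show "mat_adjoint A * (A * B) = B" .
  have "A * (mat_adjoint A * B) = A * mat_adjoint A * B"
    by (rule assoc_mult_mat[OF c(1,3,2), symmetric])
  also have "\<dots> = B" using A c by (simp add: unitary_group_def)
  finally show "A * (mat_adjoint A * B) = B" .
qed

text \<open>
  Invariance is assumed for images of sets, whereas a push-forward is computed from preimages; the
  preimage under multiplication by \<^term>\<open>A\<close> is the image under multiplication by its adjoint.
\<close>
lemma haar_measure_distr_left_mult:
  assumes \<mu>: "normalized_haar_measure n \<mu>" and A: "A \<in> unitary_group n"
  shows "distr \<mu> (borel_of (unitary_topology n)) (\<lambda>B. A * B) = \<mu>"
proof (rule measure_eqI)
  let ?T = "borel_of (unitary_topology n)"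
  have sets: "sets \<mu> = sets ?T" using \<mu> by (simp add: normalized_haar_measure_def)
  then show "sets (distr \<mu> ?T (\<lambda>B. A * B)) = sets \<mu>" by simp
  have sp: "space \<mu> = unitary_group n"
    using sets_eq_imp_space_eq[OF sets] by (simp add: space_borel_of topspace_unitary_topology)
  have m: "(\<lambda>B. A * B) \<in> measurable \<mu> ?T"
    using continuous_map_measurable_borel_of[OF continuous_map_unitary_left_mult[OF A]]
      measurable_cong_sets[OF sets refl] by blast
  fix S assume "S \<in> sets (distr \<mu> ?T (\<lambda>B. A * B))"
  then have S: "S \<in> sets ?T" by simp
  then have SU: "S \<subseteq> unitary_group n"
    using sets.sets_into_space[OF S] by (simp add: space_borel_of topspace_unitary_topology)
  have "(\<lambda>B. A * B) -` S \<inter> space \<mu> = (\<lambda>B. mat_adjoint A * B) ` S"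
  proof (intro equalityI subsetI)
    fix B assume "B \<in> (\<lambda>B. A * B) -` S \<inter> space \<mu>"
    then have B: "B \<in> unitary_group n" "A * B \<in> S" by (auto simp: sp)
    show "B \<in> (\<lambda>B. mat_adjoint A * B) ` S"
      by (rule image_eqI[where x = "A * B"])
         (use unitary_left_cancel(1)[OF A B(1)] B(2) in simp_all)
  next
    fix B assume "B \<in> (\<lambda>B. mat_adjoint A * B) ` S"
    then obtain C where C: "C \<in> S" "B = mat_adjoint A * C" by auto
    then have "C \<in> unitary_group n" using SU by blast
    with C show "B \<in> (\<lambda>B. A * B) -` S \<inter> space \<mu>"
      using unitary_left_cancel(2)[OF A, of C] unitary_mult_closed[OF unitary_adjoint[OF A], of C]
      by (simp add: sp)
  qed
  then have "emeasure (distr \<mu> ?T (\<lambda>B. A * B)) S = emeasure \<mu> ((\<lambda>B. mat_adjoint A * B) ` S)"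
    using emeasure_distr[OF m S] by simp
  also have "\<dots> = emeasure \<mu> S"
    using \<mu> unitary_adjoint[OF A] S sets by (simp add: normalized_haar_measure_def)
  finally show "emeasure (distr \<mu> ?T (\<lambda>B. A * B)) S = emeasure \<mu> S" .
qed

locale haar_random_unitary = prob_space M for M :: "'a measure" +
  fixes n :: nat and U :: "'a \<Rightarrow> complex mat"
  assumes haar: "haar_unitary M n U"
begin

lemma U_measurable: "U \<in> measurable M (borel_of (unitary_topology n))"
  using haar by (simp add: haar_unitary_def)

lemma U_unitary: "\<omega> \<in> space M \<Longrightarrow> U \<omega> \<in> unitary_group n"
  using measurable_space[OF U_measurable] by (simp add: space_borel_of topspace_unitary_topology)

lemma U_carrier: "\<omega> \<in> space M \<Longrightarrow> U \<omega> \<in> carrier_mat n n"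
  using U_unitary by (simp add: unitary_group_def)

lemma entry_measurable:
  assumes "i < n" "j < n"
  shows "(\<lambda>\<omega>. U \<omega> $$ (i, j)) \<in> borel_measurable M"
  using measurable_comp[OF U_measurable borel_measurable_borel_ofI[OF continuous_map_unitary_entry[OF assms]]]
  by (simp add: comp_def)

lemma expectation_left_mult:
  fixes f :: "complex mat \<Rightarrow> real"
  assumes A: "A \<in> unitary_group n" and f: "f \<in> borel_measurable (borel_of (unitary_topology n))"
  shows "(\<integral>\<omega>. f (A * U \<omega>) \<partial>M) = (\<integral>\<omega>. f (U \<omega>) \<partial>M)"
proof -
  let ?T = "borel_of (unitary_topology n)"
  have AT: "(\<lambda>B. A * B) \<in> measurable ?T ?T"
    by (rule continuous_map_measurable_borel_of[OF continuous_map_unitary_left_mult[OF A]])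
  have "(\<integral>\<omega>. f (A * U \<omega>) \<partial>M) = (\<integral>B. f (A * B) \<partial>distr M ?T U)"
    by (rule integral_distr[OF U_measurable, symmetric]) (rule measurable_compose[OF AT f])
  also have "\<dots> = (\<integral>B. f B \<partial>distr (distr M ?T U) ?T (\<lambda>B. A * B))"
    by (rule integral_distr[symmetric]) (use AT f in auto)
  also have "distr (distr M ?T U) ?T (\<lambda>B. A * B) = distr M ?T U"
    by (rule haar_measure_distr_left_mult[OF _ A]) (use haar in \<open>simp add: haar_unitary_def\<close>)
  also have "(\<integral>B. f B \<partial>distr M ?T U) = (\<integral>\<omega>. f (U \<omega>) \<partial>M)"
    by (rule integral_distr[OF U_measurable f])
  finally show ?thesis .
qed

lemma entry_sq_sum:
  assumes "\<omega> \<in> space M" "c < n"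
  shows "(\<Sum>a<n. (cmod (U \<omega> $$ (a, c)))\<^sup>2) = 1"
proof -
  have "complex_of_real (\<Sum>a<n. (cmod (U \<omega> $$ (a, c)))\<^sup>2) = 1"
    using unitary_columns_orthonormal[OF U_unitary[OF assms(1)] assms(2) assms(2)]
    unfolding of_real_sum complex_norm_square by simp
  then show ?thesis by (simp only: of_real_eq_1_iff)
qed

lemma entry_bound:
  assumes "\<omega> \<in> space M" "a < n" "c < n"
  shows "cmod (U \<omega> $$ (a, c)) \<le> 1"
proof -
  have "(cmod (U \<omega> $$ (a, c)))\<^sup>2 \<le> 1"
    using member_le_sum[of a "{..<n}" "\<lambda>a. (cmod (U \<omega> $$ (a, c)))\<^sup>2"] entry_sq_sum[OF assms(1,3)] assms by simp
  then show ?thesis by (simp add: power_le_one_iff)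
qed

lemma combination_measurable:
  "c < n \<Longrightarrow> (\<lambda>\<omega>. \<Sum>a<n. v a * U \<omega> $$ (a, c)) \<in> borel_measurable M"
  using entry_measurable by (intro borel_measurable_sum borel_measurable_times) auto

lemma combination_integrable:
  assumes "c < n"
  shows "integrable M (\<lambda>\<omega>. (cmod (\<Sum>a<n. v a * U \<omega> $$ (a, c)))\<^sup>2)"
proof (rule integrable_const_bound[of _ "(\<Sum>a<n. cmod (v a))\<^sup>2"])
  show "AE \<omega> in M. norm ((cmod (\<Sum>a<n. v a * U \<omega> $$ (a, c)))\<^sup>2) \<le> (\<Sum>a<n. cmod (v a))\<^sup>2"
  proof (rule AE_I2)
    fix \<omega> assume \<omega>: "\<omega> \<in> space M"
    have "cmod (\<Sum>a<n. v a * U \<omega> $$ (a, c)) \<le> (\<Sum>a<n. cmod (v a) * 1)"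
      by (rule order_trans[OF norm_sum], rule sum_mono)
         (use entry_bound[OF \<omega> _ assms] in \<open>auto simp: norm_mult intro!: mult_left_le\<close>)
    then show "norm ((cmod (\<Sum>a<n. v a * U \<omega> $$ (a, c)))\<^sup>2) \<le> (\<Sum>a<n. cmod (v a))\<^sup>2"
      by (simp add: power_mono)
  qed
qed (use combination_measurable[OF assms] in measurable)

lemma mult_entry:
  assumes "\<omega> \<in> space M" "A \<in> unitary_group n" "i < n" "j < n"
  shows "(A * U \<omega>) $$ (i, j) = (\<Sum>a<n. A $$ (i, a) * U \<omega> $$ (a, j))"
  using assms U_carrier[OF assms(1)] by (intro mult_mat_index) (auto simp: unitary_group_def)

text \<open>
  Left invariance at the level of test functions of a block.
\<close>
lemma expectation_row_mult:
  assumes q: "orthonormal_on n {..<n} q" and h: "array_test_function P h"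
    and P: "\<And>i j. (i, j) \<in> P \<Longrightarrow> r i < n \<and> c j < n"
  shows "(\<integral>\<omega>. h (\<lambda>(i, j). s * (\<Sum>a<n. q (r i) a * U \<omega> $$ (a, c j))) \<partial>M) =
         (\<integral>\<omega>. h (\<lambda>(i, j). s * U \<omega> $$ (r i, c j)) \<partial>M)"
proof -
  let ?Q = "mat n n (\<lambda>(i, a). q i a)"
  have Q: "?Q \<in> unitary_group n" by (rule unitary_of_orthonormal_rows[OF q])
  have "(\<integral>\<omega>. h (\<lambda>(i, j). s * (\<Sum>a<n. q (r i) a * U \<omega> $$ (a, c j))) \<partial>M) =
      (\<integral>\<omega>. h (\<lambda>(i, j). s * (?Q * U \<omega>) $$ (r i, c j)) \<partial>M)"
  proof (intro Bochner_Integration.integral_cong[OF refl] array_test_function_cong[OF h])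
    fix \<omega> p assume \<omega>: "\<omega> \<in> space M" and p: "p \<in> P"
    obtain i j where ij: "p = (i, j)" by (cases p)
    have rc: "r i < n" "c j < n" using P p ij by auto
    have "(\<Sum>a<n. q (r i) a * U \<omega> $$ (a, c j)) = (?Q * U \<omega>) $$ (r i, c j)"
      unfolding mult_entry[OF \<omega> Q rc] by (rule sum.cong) (use rc in auto)
    then show "(case p of (i, j) \<Rightarrow> s * (\<Sum>a<n. q (r i) a * U \<omega> $$ (a, c j))) =
        (case p of (i, j) \<Rightarrow> s * (?Q * U \<omega>) $$ (r i, c j))"
      by (simp only: ij prod.case)
  qed
  also have "\<dots> = (\<integral>\<omega>. h (\<lambda>(i, j). s * U \<omega> $$ (r i, c j)) \<partial>M)"
  proof (rule expectation_left_mult[OF Q])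
    show "(\<lambda>B. h (\<lambda>(i, j). s * B $$ (r i, c j))) \<in> borel_measurable (borel_of (unitary_topology n))"
    proof (rule array_test_function_measurable[OF h])
      fix p assume "p \<in> P"
      then obtain i j where ij: "p = (i, j)" "r i < n" "c j < n" using P by (cases p) auto
      show "(\<lambda>B. case p of (i, j) \<Rightarrow> s * B $$ (r i, c j)) \<in> borel_measurable (borel_of (unitary_topology n))"
        unfolding ij prod.case
        by (intro borel_measurable_times borel_measurable_const
            borel_measurable_borel_ofI continuous_map_unitary_entry ij)
    qed
  qed
  finally show ?thesis .
qed

text \<open>
  Completing the normalised vector \<^term>\<open>v\<close> to a unitary matrix with \<^term>\<open>v\<close> in row \<^term>\<open>r\<close>
  shows that the second moment for a unit vector equals that of every entry of the column. These
  \<^term>\<open>n\<close> entries have equal second moments whose sum is one.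
\<close>
lemma combination_second_moment:
  assumes "c < n"
  shows "(\<integral>\<omega>. (cmod (\<Sum>a<n. v a * U \<omega> $$ (a, c)))\<^sup>2 \<partial>M) = (cnorm n v)\<^sup>2 / n"
proof (cases "cnorm n v = 0")
  case True
  then have "(\<Sum>a<n. (cmod (v a))\<^sup>2) = 0" using cnorm_sq[of n v] by simp
  then have "v a = 0" if "a < n" for a using that by (simp add: sum_nonneg_eq_0_iff)
  then show ?thesis using True by simp
next
  case False
  then have v0: "cnorm n v > 0" using cnorm_nonneg[of n v] by simp
  let ?u = "\<lambda>a. of_real (1 / cnorm n v) * v a"
  let ?I = "\<integral>\<omega>. (cmod (\<Sum>a<n. ?u a * U \<omega> $$ (a, c)))\<^sup>2 \<partial>M"
  have entry: "(\<integral>\<omega>. (cmod (U \<omega> $$ (r, c)))\<^sup>2 \<partial>M) = ?I" if r: "r < n" for r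
  proof -
    have "orthonormal_on n {r} ((\<lambda>_. v)(r := ?u))"
      using orthonormal_on_insert_normalized[of n "{}" "\<lambda>_. v" r v] v0 by (simp add: orthonormal_on_def)
    then obtain q where q: "q r = ?u" "orthonormal_on n {..<n} q"
      using orthonormal_extension[of "{r}" n "(\<lambda>_. v)(r := ?u)"] r by auto
    let ?Q = "mat n n (\<lambda>(i, a). q i a)"
    have Q: "?Q \<in> unitary_group n" by (rule unitary_of_orthonormal_rows[OF q(2)])
    have "(\<integral>\<omega>. (cmod (U \<omega> $$ (r, c)))\<^sup>2 \<partial>M) = (\<integral>\<omega>. (cmod ((?Q * U \<omega>) $$ (r, c)))\<^sup>2 \<partial>M)"
    proof (rule expectation_left_mult[OF Q, symmetric])
      have [measurable]: "(\<lambda>B. B $$ (r, c)) \<in> borel_measurable (borel_of (unitary_topology n))"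
        by (intro borel_measurable_borel_ofI continuous_map_unitary_entry r assms)
      show "(\<lambda>B. (cmod (B $$ (r, c)))\<^sup>2) \<in> borel_measurable (borel_of (unitary_topology n))"
        by measurable
    qed
    also have "\<dots> = ?I"
    proof (rule Bochner_Integration.integral_cong[OF refl])
      fix \<omega> assume \<omega>: "\<omega> \<in> space M"
      have "(?Q * U \<omega>) $$ (r, c) = (\<Sum>a<n. ?u a * U \<omega> $$ (a, c))"
        unfolding mult_entry[OF \<omega> Q r assms] by (rule sum.cong) (use r q(1) in auto)
      then show "(cmod ((?Q * U \<omega>) $$ (r, c)))\<^sup>2 = (cmod (\<Sum>a<n. ?u a * U \<omega> $$ (a, c)))\<^sup>2"
        by (simp only:)
    qed
    finally show ?thesis .
  qed
  have int: "integrable M (\<lambda>\<omega>. (cmod (U \<omega> $$ (r, c)))\<^sup>2)" if "r < n" for r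
  proof (rule integrable_const_bound[of _ 1])
    have "norm ((cmod (U \<omega> $$ (r, c)))\<^sup>2) \<le> 1" if "\<omega> \<in> space M" for \<omega>
      using entry_bound[OF that \<open>r < n\<close> assms] by (simp add: power_le_one)
    then show "AE \<omega> in M. norm ((cmod (U \<omega> $$ (r, c)))\<^sup>2) \<le> 1" by (rule AE_I2)
  qed (use entry_measurable[OF that assms] in measurable)
  have "1 = (\<integral>\<omega>. (\<Sum>r<n. (cmod (U \<omega> $$ (r, c)))\<^sup>2) \<partial>M)"
  proof -
    have "(\<integral>\<omega>. (\<Sum>r<n. (cmod (U \<omega> $$ (r, c)))\<^sup>2) \<partial>M) = (\<integral>\<omega>. 1 \<partial>M)"
      by (rule Bochner_Integration.integral_cong[OF refl]) (simp add: entry_sq_sum assms)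
    then show ?thesis by (simp add: prob_space)
  qed
  also have "\<dots> = (\<Sum>r<n. \<integral>\<omega>. (cmod (U \<omega> $$ (r, c)))\<^sup>2 \<partial>M)"
    by (rule Bochner_Integration.integral_sum) (use int in auto)
  also have "\<dots> = n * ?I" by (simp add: entry del: of_real_divide)
  finally have I: "?I = 1 / n" using assms by (simp add: field_simps)
  have "(cmod (\<Sum>a<n. v a * U \<omega> $$ (a, c)))\<^sup>2 =
      (cnorm n v)\<^sup>2 * (cmod (\<Sum>a<n. ?u a * U \<omega> $$ (a, c)))\<^sup>2" for \<omega>
  proof -
    have "(\<Sum>a<n. ?u a * U \<omega> $$ (a, c)) = of_real (1 / cnorm n v) * (\<Sum>a<n. v a * U \<omega> $$ (a, c))"
      by (simp only: sum_distrib_left mult.assoc)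
    then have "cmod (\<Sum>a<n. ?u a * U \<omega> $$ (a, c)) = cmod (\<Sum>a<n. v a * U \<omega> $$ (a, c)) / cnorm n v"
      using v0 by (simp add: norm_mult norm_divide)
    then show ?thesis using v0 by (simp add: power_divide)
  qed
  then have "(\<integral>\<omega>. (cmod (\<Sum>a<n. v a * U \<omega> $$ (a, c)))\<^sup>2 \<partial>M) = (cnorm n v)\<^sup>2 * ?I"
    by (simp only: integral_mult_right_zero)
  then show ?thesis by (simp only: I) simp
qed

text \<open>
  Integration over the unitary matrix for fixed rows \<^term>\<open>w\<close>. If \<^term>\<open>w\<close> were replaced by
  the orthonormal family \<^term>\<open>q\<close>, then left invariance would give the law of the block exactly;
  the replacement costs \<^term>\<open>\<eta>\<^sup>2\<close> per entry in mean square.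
\<close>
lemma near_orthonormal_rows_estimate:
  assumes h: "array_test_function ({..<k} \<times> {..<k}) h" and "K \<ge> 0" "e > 0"
    and modulus: "\<And>x y. \<bar>h x - h y\<bar> \<le> e * (1 + (\<Sum>p\<in>{..<k} \<times> {..<k}. (cmod (y p))\<^sup>2))
        + K * (\<Sum>p\<in>{..<k} \<times> {..<k}. (cmod (x p - y p))\<^sup>2)"
    and q: "orthonormal_on n {..<k} q" and wq: "\<And>i. i < k \<Longrightarrow> cnorm n (\<lambda>a. w i a - q i a) \<le> \<eta>"
    and r: "inj_on r {..<k}" "r ` {..<k} \<subseteq> {..<n}" and c: "c ` {..<k} \<subseteq> {..<n}" and "n > 0"
  shows "\<bar>(\<integral>\<omega>. h (\<lambda>(i, j). sqrt n * (\<Sum>a<n. w i a * U \<omega> $$ (a, c j))) \<partial>M)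
      - (\<integral>\<omega>. h (\<lambda>(i, j). sqrt n * U \<omega> $$ (r i, c j)) \<partial>M)\<bar> \<le> e * (1 + real k ^ 2) + K * (real k ^ 2 * \<eta>\<^sup>2)"
proof -
  let ?P = "{..<k} \<times> {..<k}"
  have cn: "c j < n" if "j < k" for j using c that by auto
  have rn: "r i < n" if "i < k" for i using r that by auto
  define x where "x \<omega> = (\<lambda>(i, j). sqrt n * (\<Sum>a<n. w i a * U \<omega> $$ (a, c j)))" for \<omega>
  define y where "y \<omega> = (\<lambda>(i, j). sqrt n * (\<Sum>a<n. q i a * U \<omega> $$ (a, c j)))" for \<omega>
  \<comment> \<open>the orthonormal family completes to a unitary matrix with prescribed row positions\<close>
  define S where "S = r ` {..<k}"
  define f where "f = the_inv_into {..<k} r"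
  have f: "f (r i) = i" if "i < k" for i
    using the_inv_into_f_f[OF r(1)] that by (simp add: f_def)
  have "orthonormal_on n S (\<lambda>l. q (f l))"
    using q r(1) by (auto simp: orthonormal_on_def S_def f inj_on_eq_iff)
  moreover have "S \<subseteq> {..<n}" using r by (simp add: S_def)
  ultimately obtain q' where q': "\<And>l. l \<in> S \<Longrightarrow> q' l = q (f l)" "orthonormal_on n {..<n} q'"
    using orthonormal_extension by metis
  have q'r: "q' (r i) = q i" if "i < k" for i
    using q'(1)[of "r i"] that f by (simp add: S_def)
  have "(\<integral>\<omega>. h (\<lambda>(i, j). sqrt n * U \<omega> $$ (r i, c j)) \<partial>M) =
      (\<integral>\<omega>. h (\<lambda>(i, j). sqrt n * (\<Sum>a<n. q' (r i) a * U \<omega> $$ (a, c j))) \<partial>M)"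
    by (rule expectation_row_mult[OF q'(2) h, symmetric]) (use cn rn in auto)
  also have "\<dots> = (\<integral>\<omega>. h (y \<omega>) \<partial>M)"
    by (intro Bochner_Integration.integral_cong[OF refl] array_test_function_cong[OF h])
       (auto simp: y_def q'r)
  finally have Y: "(\<integral>\<omega>. h (\<lambda>(i, j). sqrt n * U \<omega> $$ (r i, c j)) \<partial>M) = (\<integral>\<omega>. h (y \<omega>) \<partial>M)" .
  obtain B where "B > 0" and B: "\<And>x. \<bar>h x\<bar> \<le> B" using array_test_function_bound[OF h] by metis
  have hint: "integrable M (\<lambda>\<omega>. h (\<lambda>(i, j). sqrt n * (\<Sum>a<n. v i a * U \<omega> $$ (a, c j))))" for v
  proof (rule integrable_const_bound[of _ B])
    show "(\<lambda>\<omega>. h (\<lambda>(i, j). sqrt n * (\<Sum>a<n. v i a * U \<omega> $$ (a, c j)))) \<in> borel_measurable M"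
    proof (rule array_test_function_measurable[OF h])
      fix p assume "p \<in> ?P"
      then obtain i j where ij: "p = (i, j)" "j < k" by auto
      show "(\<lambda>\<omega>. case p of (i, j) \<Rightarrow> sqrt n * (\<Sum>a<n. v i a * U \<omega> $$ (a, c j))) \<in> borel_measurable M"
        unfolding ij prod.case
        by (intro borel_measurable_times borel_measurable_const combination_measurable cn ij)
    qed
  qed (use B in auto)
  have entry: "integrable M (\<lambda>\<omega>. (cmod (sqrt n * (\<Sum>a<n. v a * U \<omega> $$ (a, c j))))\<^sup>2) \<and>
      (\<integral>\<omega>. (cmod (sqrt n * (\<Sum>a<n. v a * U \<omega> $$ (a, c j))))\<^sup>2 \<partial>M) = (cnorm n v)\<^sup>2" if "j < k" for v j
  proof -
    have "(cmod (sqrt n * z))\<^sup>2 = real n * (cmod z)\<^sup>2" for z :: complex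
      by (simp add: norm_mult power_mult_distrib)
    then show ?thesis
      using combination_integrable[OF cn[OF that], of v] combination_second_moment[OF cn[OF that], of v] \<open>n > 0\<close>
      by simp
  qed
  have qn: "(cnorm n (q i))\<^sup>2 = 1" if "i < k" for i
  proof -
    have "complex_of_real ((cnorm n (q i))\<^sup>2) = 1"
      using q \<open>i < k\<close> unfolding cinner_self[symmetric] orthonormal_on_def by simp
    then show ?thesis by (simp only: of_real_eq_1_iff)
  qed
  have yi: "integrable M (\<lambda>\<omega>. (cmod (y \<omega> p))\<^sup>2)" "(\<integral>\<omega>. (cmod (y \<omega> p))\<^sup>2 \<partial>M) = 1" if "p \<in> ?P" for p
    using that entry qn by (auto simp: y_def)
  have xy: "integrable M (\<lambda>\<omega>. (cmod (x \<omega> p - y \<omega> p))\<^sup>2)" "(\<integral>\<omega>. (cmod (x \<omega> p - y \<omega> p))\<^sup>2 \<partial>M) \<le> \<eta>\<^sup>2"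
    if p: "p \<in> ?P" for p
  proof -
    obtain i j where ij: "p = (i, j)" "i < k" "j < k" using p by auto
    have "x \<omega> p - y \<omega> p = sqrt n * (\<Sum>a<n. (w i a - q i a) * U \<omega> $$ (a, c j))" for \<omega>
      by (simp add: x_def y_def ij left_diff_distrib sum_subtractf right_diff_distrib)
    moreover have "(cnorm n (\<lambda>a. w i a - q i a))\<^sup>2 \<le> \<eta>\<^sup>2"
      using wq[OF ij(2)] cnorm_nonneg by (intro power_mono) auto
    ultimately show "integrable M (\<lambda>\<omega>. (cmod (x \<omega> p - y \<omega> p))\<^sup>2)"
        "(\<integral>\<omega>. (cmod (x \<omega> p - y \<omega> p))\<^sup>2 \<partial>M) \<le> \<eta>\<^sup>2"
      using entry[OF ij(3), of "\<lambda>a. w i a - q i a"] by simp_all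
  qed
  have hx: "integrable M (\<lambda>\<omega>. h (x \<omega>))" and hy: "integrable M (\<lambda>\<omega>. h (y \<omega>))"
    unfolding x_def y_def by (rule hint)+
  have "\<bar>(\<integral>\<omega>. h (x \<omega>) \<partial>M) - (\<integral>\<omega>. h (y \<omega>) \<partial>M)\<bar> = \<bar>\<integral>\<omega>. h (x \<omega>) - h (y \<omega>) \<partial>M\<bar>"
    by (simp add: hx hy)
  also have "\<dots> \<le> (\<integral>\<omega>. \<bar>h (x \<omega>) - h (y \<omega>)\<bar> \<partial>M)"
    by (rule integral_abs_bound)
  also have "\<dots> \<le> (\<integral>\<omega>. e * (1 + (\<Sum>p\<in>?P. (cmod (y \<omega> p))\<^sup>2)) + K * (\<Sum>p\<in>?P. (cmod (x \<omega> p - y \<omega> p))\<^sup>2) \<partial>M)"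
    by (intro integral_mono modulus)
       (auto intro!: Bochner_Integration.integrable_add integrable_mult_right Bochner_Integration.integrable_sum
          integrable_abs Bochner_Integration.integrable_diff hx hy yi xy)
  also have "\<dots> = e * (1 + (\<Sum>p\<in>?P. \<integral>\<omega>. (cmod (y \<omega> p))\<^sup>2 \<partial>M)) +
      K * (\<Sum>p\<in>?P. \<integral>\<omega>. (cmod (x \<omega> p - y \<omega> p))\<^sup>2 \<partial>M)"
    using yi(1) xy(1) by (simp add: Bochner_Integration.integral_add Bochner_Integration.integral_sum prob_space)
  also have "\<dots> \<le> e * (1 + (\<Sum>p\<in>?P. 1)) + K * (\<Sum>p\<in>?P. \<eta>\<^sup>2)"
    using yi(2) xy(2) \<open>K \<ge> 0\<close> \<open>e > 0\<close> by (intro add_mono mult_left_mono sum_mono) auto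
  also have "\<dots> = e * (1 + real k ^ 2) + K * (real k ^ 2 * \<eta>\<^sup>2)"
    by (simp add: card_cartesian_product power2_eq_square)
  finally show ?thesis unfolding Y by (simp only: x_def)
qed

end

section \<open>Complex Gaussian random variables\<close>

lemma (in prob_space) normal_char:
  assumes X: "distributed M lborel X (normal_density 0 \<sigma>)" and \<sigma>: "\<sigma> > 0"
  shows "(\<integral>\<omega>. iexp (t * X \<omega>) \<partial>M) = of_real (exp (- (\<sigma> * t)\<^sup>2 / 2))"
proof -
  have S: "distributed M lborel (\<lambda>\<omega>. X \<omega> / \<sigma>) std_normal_density"
    using X unfolding normal_standard_normal_convert[OF \<sigma>] by simp
  then have Sm: "(\<lambda>\<omega>. X \<omega> / \<sigma>) \<in> borel_measurable M"
    by (auto dest: distributed_measurable)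
  have "distr M borel (\<lambda>\<omega>. X \<omega> / \<sigma>) = distr M lborel (\<lambda>\<omega>. X \<omega> / \<sigma>)"
    by (rule distr_cong) auto
  also have "\<dots> = std_normal_distribution"
    by (rule distributed_distr_eq_density[OF S])
  finally have law: "distr M borel (\<lambda>\<omega>. X \<omega> / \<sigma>) = std_normal_distribution" .
  have "(\<integral>\<omega>. iexp (t * X \<omega>) \<partial>M) = (\<integral>\<omega>. iexp (\<sigma> * t * (X \<omega> / \<sigma>)) \<partial>M)"
    using \<sigma> by (intro Bochner_Integration.integral_cong) auto
  also have "\<dots> = (\<integral>s. iexp (\<sigma> * t * s) \<partial>distr M borel (\<lambda>\<omega>. X \<omega> / \<sigma>))"
    by (rule integral_distr[symmetric]) (use Sm in measurable)
  also have "\<dots> = char std_normal_distribution (\<sigma> * t)"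
    unfolding law char_def ..
  finally show ?thesis by (simp add: char_std_normal_distribution)
qed

lemma (in prob_space) normal_moments:
  assumes X: "distributed M lborel X (normal_density 0 \<sigma>)" and \<sigma>: "\<sigma> > 0"
  shows "integrable M (\<lambda>\<omega>. X \<omega> ^ m)" "(\<integral>\<omega>. X \<omega> \<partial>M) = 0" "(\<integral>\<omega>. (X \<omega>)\<^sup>2 \<partial>M) = \<sigma>\<^sup>2"
proof -
  have "integrable lborel (\<lambda>x. normal_density 0 \<sigma> x * x ^ m)"
    using integrable_normal_moment[OF \<sigma>, of 0 m] by simp
  then show "integrable M (\<lambda>\<omega>. X \<omega> ^ m)"
    by (subst distributed_integrable[OF X, symmetric]) auto
  have "(\<integral>\<omega>. X \<omega> \<partial>M) = (\<integral>x. normal_density 0 \<sigma> x * x \<partial>lborel)"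
    by (rule distributed_integral[OF X, symmetric]) auto
  also have "\<dots> = 0" by (rule integral_normal_moment_nz_1[OF \<sigma>])
  finally show "(\<integral>\<omega>. X \<omega> \<partial>M) = 0" .
  have "(\<integral>\<omega>. (X \<omega>)\<^sup>2 \<partial>M) = (\<integral>x. normal_density 0 \<sigma> x * x\<^sup>2 \<partial>lborel)"
    by (rule distributed_integral[OF X, symmetric]) auto
  also have "\<dots> = \<sigma>\<^sup>2" using integral_normal_moment_even[OF \<sigma>, of 0 1] by simp
  finally show "(\<integral>\<omega>. (X \<omega>)\<^sup>2 \<partial>M) = \<sigma>\<^sup>2" .
qed

lemma (in prob_space) complex_gaussian_measurable:
  assumes "complex_gaussian M v Z"
  shows "Z \<in> borel_measurable M"
proof -
  have "(\<lambda>\<omega>. Re (Z \<omega>)) \<in> borel_measurable M" "(\<lambda>\<omega>. Im (Z \<omega>)) \<in> borel_measurable M"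
    using assms by (auto simp: complex_gaussian_def dest: distributed_measurable)
  then show ?thesis by (simp add: borel_measurable_complex_iff)
qed

lemma (in prob_space) complex_gaussian_char:
  assumes Z: "complex_gaussian M 1 Z"
  shows "(\<integral>\<omega>. iexp (Re (w * Z \<omega>)) \<partial>M) = of_real (exp (- (cmod w)\<^sup>2 / 4))"
proof -
  have X: "distributed M lborel (\<lambda>\<omega>. Re (Z \<omega>)) (normal_density 0 (sqrt (1 / 2)))"
    and Y: "distributed M lborel (\<lambda>\<omega>. Im (Z \<omega>)) (normal_density 0 (sqrt (1 / 2)))"
    and XY: "indep_var borel (\<lambda>\<omega>. Re (Z \<omega>)) borel (\<lambda>\<omega>. Im (Z \<omega>))"
    using Z by (auto simp: complex_gaussian_def)
  note [measurable] = complex_gaussian_measurable[OF Z]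
  have bounded: "integrable M (\<lambda>\<omega>. iexp (f \<omega>))" if [measurable]: "f \<in> borel_measurable M" for f
    by (rule integrable_const_bound[of _ 1]) auto
  have "(\<integral>\<omega>. iexp (Re (w * Z \<omega>)) \<partial>M) = (\<integral>\<omega>. iexp (Re w * Re (Z \<omega>)) * iexp (- Im w * Im (Z \<omega>)) \<partial>M)"
    by (intro Bochner_Integration.integral_cong refl) (simp add: exp_add[symmetric] algebra_simps)
  also have "\<dots> = (\<integral>\<omega>. iexp (Re w * Re (Z \<omega>)) \<partial>M) * (\<integral>\<omega>. iexp (- Im w * Im (Z \<omega>)) \<partial>M)"
  proof (rule indep_var_lebesgue_integral)
    have "indep_var borel ((\<lambda>x. iexp (Re w * x)) \<circ> (\<lambda>\<omega>. Re (Z \<omega>))) borel ((\<lambda>x. iexp (- Im w * x)) \<circ> (\<lambda>\<omega>. Im (Z \<omega>)))"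
      by (rule indep_var_compose[OF XY]) measurable
    then show "indep_var borel (\<lambda>\<omega>. iexp (Re w * Re (Z \<omega>))) borel (\<lambda>\<omega>. iexp (- Im w * Im (Z \<omega>)))"
      by (simp only: comp_def)
  qed (rule bounded; measurable)+
  also have "\<dots> = of_real (exp (- (sqrt (1 / 2) * Re w)\<^sup>2 / 2)) * of_real (exp (- (sqrt (1 / 2) * - Im w)\<^sup>2 / 2))"
    by (simp only: normal_char[OF X] normal_char[OF Y] real_sqrt_gt_0_iff zero_less_divide_1_iff zero_less_numeral)
  also have "\<dots> = of_real (exp (- (sqrt (1 / 2) * Re w)\<^sup>2 / 2 + - (sqrt (1 / 2) * - Im w)\<^sup>2 / 2))"
    by (simp only: exp_add of_real_mult)
  also have "- (sqrt (1 / 2) * Re w)\<^sup>2 / 2 + - (sqrt (1 / 2) * - Im w)\<^sup>2 / 2 = - (cmod w)\<^sup>2 / 4"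
    by (simp add: power_mult_distrib cmod_power2 real_sqrt_divide power_divide field_simps)
  finally show ?thesis .
qed

lemma (in prob_space) complex_gaussian_moments:
  assumes Z: "complex_gaussian M 1 Z"
  shows "integrable M Z" "(\<integral>\<omega>. Z \<omega> \<partial>M) = 0"
    "integrable M (\<lambda>\<omega>. (cmod (Z \<omega>))\<^sup>2)" "(\<integral>\<omega>. (cmod (Z \<omega>))\<^sup>2 \<partial>M) = 1"
    "integrable M (\<lambda>\<omega>. (cmod (Z \<omega>)) ^ 4)"
proof -
  have X: "distributed M lborel (\<lambda>\<omega>. Re (Z \<omega>)) (normal_density 0 (sqrt (1 / 2)))"
    and Y: "distributed M lborel (\<lambda>\<omega>. Im (Z \<omega>)) (normal_density 0 (sqrt (1 / 2)))"
    using Z by (auto simp: complex_gaussian_def)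
  have s: "0 < sqrt (1 / 2 :: real)" by simp
  note [measurable] = complex_gaussian_measurable[OF Z]
  note mX = normal_moments[OF X s] and mY = normal_moments[OF Y s]
  have i1: "integrable M (\<lambda>\<omega>. Re (Z \<omega>))" "integrable M (\<lambda>\<omega>. Im (Z \<omega>))"
    using mX(1)[of 1] mY(1)[of 1] by simp_all
  have Zeq: "Z = (\<lambda>\<omega>. of_real (Re (Z \<omega>)) + \<i> * of_real (Im (Z \<omega>)))"
    by (simp add: fun_eq_iff complex_eq)
  have "integrable M (\<lambda>\<omega>. of_real (Re (Z \<omega>)) + \<i> * of_real (Im (Z \<omega>)))"
    using i1 by (intro Bochner_Integration.integrable_add integrable_mult_right integrable_of_real)
  then show iZ: "integrable M Z" by (simp only: Zeq[symmetric])
  show "(\<integral>\<omega>. Z \<omega> \<partial>M) = 0"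
  proof (rule complex_eqI)
    show "Re (\<integral>\<omega>. Z \<omega> \<partial>M) = Re 0" using mX(2) by (simp add: Bochner_Integration.integral_Re[OF iZ, symmetric])
    show "Im (\<integral>\<omega>. Z \<omega> \<partial>M) = Im 0" using mY(2) by (simp add: Bochner_Integration.integral_Im[OF iZ, symmetric])
  qed
  show "integrable M (\<lambda>\<omega>. (cmod (Z \<omega>))\<^sup>2)"
    unfolding cmod_power2 by (intro Bochner_Integration.integrable_add mX(1) mY(1))
  have "(\<integral>\<omega>. (cmod (Z \<omega>))\<^sup>2 \<partial>M) = (\<integral>\<omega>. (Re (Z \<omega>))\<^sup>2 \<partial>M) + (\<integral>\<omega>. (Im (Z \<omega>))\<^sup>2 \<partial>M)"
    unfolding cmod_power2 by (intro Bochner_Integration.integral_add mX(1) mY(1))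
  then show "(\<integral>\<omega>. (cmod (Z \<omega>))\<^sup>2 \<partial>M) = 1" by (simp add: mX(3) mY(3))
  show "integrable M (\<lambda>\<omega>. (cmod (Z \<omega>)) ^ 4)"
  proof (rule Bochner_Integration.integrable_bound)
    show "integrable M (\<lambda>\<omega>. 2 * Re (Z \<omega>) ^ 4 + 2 * Im (Z \<omega>) ^ 4)"
      by (intro Bochner_Integration.integrable_add integrable_mult_right mX(1) mY(1))
    have "(cmod z) ^ 4 \<le> 2 * Re z ^ 4 + 2 * Im z ^ 4" for z
    proof -
      have "(cmod z) ^ 4 = ((Re z)\<^sup>2 + (Im z)\<^sup>2)\<^sup>2"
        by (simp flip: cmod_power2)
      also have "\<dots> \<le> 2 * ((Re z)\<^sup>2)\<^sup>2 + 2 * ((Im z)\<^sup>2)\<^sup>2"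
        using sum_squares_bound[of "(Re z)\<^sup>2" "(Im z)\<^sup>2"] by (simp add: power2_sum)
      finally show ?thesis by simp
    qed
    then show "AE \<omega> in M. norm ((cmod (Z \<omega>)) ^ 4) \<le> norm (2 * Re (Z \<omega>) ^ 4 + 2 * Im (Z \<omega>) ^ 4)"
      by (intro AE_I2) (auto intro: order_trans[OF _ abs_ge_self])
  qed measurable
qed

text \<open>
  The cross terms vanish since distinct coordinates of a product measure are independent and
  \<^term>\<open>W\<close> is centred.
\<close>
lemma iid_centered_sum_second_moment:
  fixes W :: "'b \<Rightarrow> complex"
  assumes N: "prob_space N" and Wm [measurable]: "W \<in> borel_measurable N"
    and W2: "integrable N (\<lambda>y. (cmod (W y))\<^sup>2)" and W0: "(\<integral>y. W y \<partial>N) = 0"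
  shows "integrable (PiM {..<n::nat} (\<lambda>_. N)) (\<lambda>x. (cmod (\<Sum>a<n. W (x a)))\<^sup>2)"
    and "(\<integral>x. (cmod (\<Sum>a<n. W (x a)))\<^sup>2 \<partial>PiM {..<n} (\<lambda>_. N)) = n * (\<integral>y. (cmod (W y))\<^sup>2 \<partial>N)"
proof -
  interpret N: prob_space N by fact
  interpret P: product_sigma_finite "\<lambda>_::nat. N" by standard
  let ?Z = "PiM {..<n} (\<lambda>_. N)"
  let ?V = "\<integral>y. (cmod (W y))\<^sup>2 \<partial>N"
  have W1: "integrable N W"
  proof (rule Bochner_Integration.integrable_bound)
    show "integrable N (\<lambda>y. 1 + (cmod (W y))\<^sup>2)" using W2 by simp
    have "t \<le> 1 + t\<^sup>2" if "t \<ge> 0" for t :: real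
      using zero_le_power2[of "t - 1"] that by (simp add: power2_diff)
    then show "AE y in N. norm (W y) \<le> norm (1 + (cmod (W y))\<^sup>2)"
      by (intro AE_I2) (auto intro: order_trans[OF _ abs_ge_self])
  qed measurable
  have WW: "integrable N (\<lambda>y. W y * cnj (W y))" "(\<integral>y. W y * cnj (W y) \<partial>N) = of_real ?V"
    unfolding complex_norm_square[symmetric]
    using W2 by (simp_all only: integrable_of_real Bochner_Integration.integral_of_real)
  \<comment> \<open>Each product of two summands is a product function on the product space; writing it with two
    conditionals covers the diagonal case as well.\<close>
  define f where "f a b c y = (if c = a then W y else 1) * (if c = b then cnj (W y) else 1)" for a b c :: nat and y
  have fprod: "(\<Prod>c<n. f a b c (x c)) = W (x a) * cnj (W (x b))" if "a < n" "b < n" for a b and x :: "nat \<Rightarrow> 'b"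
    using that unfolding f_def prod.distrib by simp
  have fint: "integrable N (f a b c)" for a b c
    using W1 WW(1) unfolding f_def by (cases "c = a"; cases "c = b") auto
  have fval: "(\<Prod>c<n. \<integral>y. f a b c y \<partial>N) = (if a = b then of_real ?V else 0)" if "a < n" "b < n" for a b
  proof (cases "a = b")
    case True
    then have "(\<integral>y. f a b c y \<partial>N) = (if c = a then of_real ?V else 1)" for c
      using WW(2) by (simp add: f_def N.prob_space)
    then show ?thesis using True that by simp
  next
    case False
    then have "(\<integral>y. f a b a y \<partial>N) = 0" using W0 by (simp add: f_def)
    then show ?thesis using False that by (auto intro!: prod_zero)
  qed
  have pair: "integrable ?Z (\<lambda>x. W (x a) * cnj (W (x b)))"
      "(\<integral>x. W (x a) * cnj (W (x b)) \<partial>?Z) = (if a = b then of_real ?V else 0)" if "a < n" "b < n" for a b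
    using P.product_integrable_prod[of "{..<n}" "f a b"] P.product_integral_prod[of "{..<n}" "f a b"] fint
    unfolding fprod[OF that] fval[OF that] by auto
  have expand: "complex_of_real ((cmod (\<Sum>a<n. W (x a)))\<^sup>2) = (\<Sum>a<n. \<Sum>b<n. W (x a) * cnj (W (x b)))" for x
    unfolding complex_norm_square cnj_sum sum_product ..
  have int: "integrable ?Z (\<lambda>x. complex_of_real ((cmod (\<Sum>a<n. W (x a)))\<^sup>2))"
    unfolding expand by (intro Bochner_Integration.integrable_sum pair) auto
  from integrable_Re[OF this] show "integrable ?Z (\<lambda>x. (cmod (\<Sum>a<n. W (x a)))\<^sup>2)"
    by (simp only: Re_complex_of_real)
  have "complex_of_real (\<integral>x. (cmod (\<Sum>a<n. W (x a)))\<^sup>2 \<partial>?Z) = (\<integral>x. complex_of_real ((cmod (\<Sum>a<n. W (x a)))\<^sup>2) \<partial>?Z)"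
    by (rule integral_complex_of_real[symmetric])
  also have "\<dots> = (\<Sum>a<n. \<Sum>b<n. \<integral>x. W (x a) * cnj (W (x b)) \<partial>?Z)"
    unfolding expand
    by (subst Bochner_Integration.integral_sum, (intro Bochner_Integration.integrable_sum pair; simp),
        intro sum.cong refl Bochner_Integration.integral_sum pair) auto
  also have "\<dots> = (\<Sum>a<n. \<Sum>b<n. if a = b then of_real ?V else 0)"
    by (intro sum.cong refl pair(2)) auto
  also have "\<dots> = of_real (n * ?V)" by simp
  finally show "(\<integral>x. (cmod (\<Sum>a<n. W (x a)))\<^sup>2 \<partial>?Z) = n * ?V"
    by (simp only: of_real_eq_iff)
qed

locale complex_gaussian_matrix = prob_space N for N :: "'b measure" +
  fixes k :: nat and G :: "nat \<Rightarrow> nat \<Rightarrow> 'b \<Rightarrow> complex"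
  assumes gauss: "\<And>i j. i < k \<Longrightarrow> j < k \<Longrightarrow> complex_gaussian N 1 (G i j)"
    and indep: "indep_vars (\<lambda>_. borel) (\<lambda>(i, j). G i j) ({..<k} \<times> {..<k})"
begin

lemma G_measurable: "i < k \<Longrightarrow> j < k \<Longrightarrow> G i j \<in> borel_measurable N"
  using complex_gaussian_measurable gauss by blast

lemma G_char:
  "(\<integral>\<omega>. iexp (\<Sum>(i, j)\<in>{..<k} \<times> {..<k}. Re (w (i, j) * G i j \<omega>)) \<partial>N) =
    of_real (exp (- (\<Sum>p\<in>{..<k} \<times> {..<k}. (cmod (w p))\<^sup>2) / 4))"
proof -
  let ?P = "{..<k} \<times> {..<k}"
  let ?X = "\<lambda>p \<omega>. iexp (Re (w p * (case p of (i, j) \<Rightarrow> G i j) \<omega>))"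
  have "indep_vars (\<lambda>_. borel) ?X ?P"
    by (rule indep_vars_compose2[OF indep]) measurable
  moreover have "integrable N (?X p)" if p: "p \<in> ?P" for p
  proof (rule integrable_const_bound[of _ 1])
    have [measurable]: "(case p of (i, j) \<Rightarrow> G i j) \<in> borel_measurable N"
      using p G_measurable by auto
    show "?X p \<in> borel_measurable N" by measurable
  qed auto
  ultimately have "(\<integral>\<omega>. (\<Prod>p\<in>?P. ?X p \<omega>) \<partial>N) = (\<Prod>p\<in>?P. \<integral>\<omega>. ?X p \<omega> \<partial>N)"
    by (intro indep_vars_lebesgue_integral) auto
  also have "\<dots> = (\<Prod>p\<in>?P. of_real (exp (- (cmod (w p))\<^sup>2 / 4)))"
  proof (rule prod.cong[OF refl])
    fix p assume "p \<in> ?P"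
    then show "(\<integral>\<omega>. ?X p \<omega> \<partial>N) = of_real (exp (- (cmod (w p))\<^sup>2 / 4))"
      using complex_gaussian_char[OF gauss] by (cases p) auto
  qed
  also have "\<dots> = of_real (exp (\<Sum>p\<in>?P. - (cmod (w p))\<^sup>2 / 4))"
    by (simp only: exp_sum finite_cartesian_product finite_lessThan of_real_prod)
  also have "(\<Sum>p\<in>?P. - (cmod (w p))\<^sup>2 / 4) = - (\<Sum>p\<in>?P. (cmod (w p))\<^sup>2) / 4"
    by (simp only: sum_divide_distrib[symmetric] sum_negf)
  finally have *: "(\<integral>\<omega>. (\<Prod>p\<in>?P. ?X p \<omega>) \<partial>N) = of_real (exp (- (\<Sum>p\<in>?P. (cmod (w p))\<^sup>2) / 4))" .
  have "iexp (\<Sum>(i, j)\<in>?P. Re (w (i, j) * G i j \<omega>)) = (\<Prod>p\<in>?P. ?X p \<omega>)" for \<omega>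
  proof -
    have "(\<Sum>(i, j)\<in>?P. Re (w (i, j) * G i j \<omega>)) = (\<Sum>p\<in>?P. Re (w p * (case p of (i, j) \<Rightarrow> G i j) \<omega>))"
      by (intro sum.cong) auto
    then show ?thesis by (simp only: of_real_sum sum_distrib_left exp_sum finite_cartesian_product finite_lessThan)
  qed
  then show ?thesis using * by (simp only:)
qed

text \<open>
  The frequencies outside the first column are set to zero in the joint characteristic function.
\<close>
lemma G_column_char:
  assumes "k > 0"
  shows "(\<integral>\<omega>. iexp (\<Sum>i<k. Re (v i * G i 0 \<omega>)) \<partial>N) = of_real (exp (- (\<Sum>i<k. (cmod (v i))\<^sup>2) / 4))"
proof -
  let ?w = "\<lambda>(i, j::nat). if j = 0 then v i else 0"
  have "(\<Sum>(i, j)\<in>{..<k} \<times> {..<k}. Re (?w (i, j) * G i j \<omega>)) = (\<Sum>i<k. Re (v i * G i 0 \<omega>))" for \<omega>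
  proof -
    have "(\<Sum>(i, j)\<in>{..<k} \<times> {..<k}. Re (?w (i, j) * G i j \<omega>)) =
        (\<Sum>i<k. \<Sum>j<k. if j = 0 then Re (v i * G i 0 \<omega>) else 0)"
      unfolding sum.cartesian_product[symmetric] by (intro sum.cong refl) auto
    then show ?thesis using assms by simp
  qed
  moreover have "(\<Sum>p\<in>{..<k} \<times> {..<k}. (cmod (?w p))\<^sup>2) = (\<Sum>i<k. (cmod (v i))\<^sup>2)"
  proof -
    have "(\<Sum>p\<in>{..<k} \<times> {..<k}. (cmod (?w p))\<^sup>2) = (\<Sum>(i, j)\<in>{..<k} \<times> {..<k}. (cmod (?w (i, j)))\<^sup>2)"
      by (intro sum.cong) auto
    also have "\<dots> = (\<Sum>i<k. \<Sum>j<k. if j = 0 then (cmod (v i))\<^sup>2 else 0)"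
      unfolding sum.cartesian_product[symmetric] by (intro sum.cong refl) auto
    finally show ?thesis using assms by simp
  qed
  ultimately show ?thesis using G_char[of ?w] by (simp only:)
qed

text \<open>
  Orthonormality of the entries of one column in mean, with finite second moments of the products;
  this is the input for the law of large numbers.
\<close>
lemma G_column_covariance:
  assumes "i < k" "j < k"
  shows "integrable N (\<lambda>\<omega>. G i 0 \<omega> * cnj (G j 0 \<omega>))"
    and "(\<integral>\<omega>. G i 0 \<omega> * cnj (G j 0 \<omega>) \<partial>N) = of_bool (i = j)"
    and "integrable N (\<lambda>\<omega>. (cmod (G i 0 \<omega> * cnj (G j 0 \<omega>) - of_bool (i = j)))\<^sup>2)"
proof -
  have k: "0 < k" using assms by simp
  note mi = complex_gaussian_moments[OF gauss[OF assms(1) k]] and mj = complex_gaussian_moments[OF gauss[OF assms(2) k]]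
  have [measurable]: "G i 0 \<in> borel_measurable N" "G j 0 \<in> borel_measurable N"
    using G_measurable assms k by auto
  have cnj_measurable [measurable]: "cnj \<in> borel_measurable borel"
    by (intro borel_measurable_continuous_onI continuous_intros)
  have "integrable N (\<lambda>\<omega>. G i 0 \<omega> * cnj (G j 0 \<omega>)) \<and> (\<integral>\<omega>. G i 0 \<omega> * cnj (G j 0 \<omega>) \<partial>N) = of_bool (i = j)"
  proof (cases "i = j")
    case True
    have "(\<lambda>\<omega>. G i 0 \<omega> * cnj (G j 0 \<omega>)) = (\<lambda>\<omega>. complex_of_real ((cmod (G i 0 \<omega>))\<^sup>2))"
      unfolding complex_norm_square True ..
    then show ?thesis
      using mi(3,4) True by (simp only: integrable_of_real Bochner_Integration.integral_of_real) simp
  next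
    case False
    let ?J = "{(i, 0::nat), (j, 0)}"
    let ?X = "\<lambda>p \<omega>. (if p = (i, 0) then (case p of (i, j) \<Rightarrow> G i j) \<omega> else cnj ((case p of (i, j) \<Rightarrow> G i j) \<omega>))"
    have "indep_vars (\<lambda>_. borel) (\<lambda>(i, j). G i j) ?J"
      by (rule indep_vars_subset[OF indep]) (use assms k in auto)
    then have ind: "indep_vars (\<lambda>_. borel) ?X ?J"
      by (rule indep_vars_compose2[where Y = "\<lambda>p z. if p = (i, 0) then z else cnj z"])
         (use cnj_measurable in auto)
    have int: "integrable N (?X p)" if "p \<in> ?J" for p
      using that False mi(1) mj(1) by auto
    have "(\<lambda>\<omega>. \<Prod>p\<in>?J. ?X p \<omega>) = (\<lambda>\<omega>. G i 0 \<omega> * cnj (G j 0 \<omega>))"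
      using False by simp
    then show ?thesis
      using indep_vars_integrable[OF _ ind int] indep_vars_lebesgue_integral[OF _ ind int] False mi(2) by simp
  qed
  then show "integrable N (\<lambda>\<omega>. G i 0 \<omega> * cnj (G j 0 \<omega>))"
      "(\<integral>\<omega>. G i 0 \<omega> * cnj (G j 0 \<omega>) \<partial>N) = of_bool (i = j)" by auto
  show "integrable N (\<lambda>\<omega>. (cmod (G i 0 \<omega> * cnj (G j 0 \<omega>) - of_bool (i = j)))\<^sup>2)"
  proof (rule Bochner_Integration.integrable_bound)
    show "integrable N (\<lambda>\<omega>. 2 * (cmod (G i 0 \<omega>) ^ 4 + cmod (G j 0 \<omega>) ^ 4) + 2)"
      using mi(5) mj(5) by (intro Bochner_Integration.integrable_add integrable_mult_right) auto
    have "(cmod (y * cnj z - d))\<^sup>2 \<le> 2 * (cmod y ^ 4 + cmod z ^ 4) + 2" if "cmod d \<le> 1" for y z d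
    proof -
      have "cmod (y * cnj z - d) \<le> cmod y * cmod z + 1"
        using norm_triangle_ineq4[of "y * cnj z" d] that by (simp add: norm_mult)
      then have "(cmod (y * cnj z - d))\<^sup>2 \<le> (cmod y * cmod z + 1)\<^sup>2"
        by (intro power_mono) auto
      also have "\<dots> \<le> 2 * (cmod y * cmod z)\<^sup>2 + 2"
        using zero_le_power2[of "cmod y * cmod z - 1"] by (simp add: power2_diff power2_sum)
      also have "(cmod y * cmod z)\<^sup>2 \<le> cmod y ^ 4 + cmod z ^ 4"
      proof -
        have "2 * (cmod y)\<^sup>2 * (cmod z)\<^sup>2 \<le> ((cmod y)\<^sup>2)\<^sup>2 + ((cmod z)\<^sup>2)\<^sup>2" by (rule sum_squares_bound)
        moreover have "0 \<le> (cmod y)\<^sup>2 * (cmod z)\<^sup>2" by simp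
        ultimately have "(cmod y)\<^sup>2 * (cmod z)\<^sup>2 \<le> ((cmod y)\<^sup>2)\<^sup>2 + ((cmod z)\<^sup>2)\<^sup>2"
          unfolding mult.assoc by linarith
        then show ?thesis by (simp add: power_mult_distrib)
      qed
      finally show ?thesis by simp
    qed
    from this[of "of_bool (i = j)"]
    show "AE \<omega> in N. norm ((cmod (G i 0 \<omega> * cnj (G j 0 \<omega>) - of_bool (i = j)))\<^sup>2) \<le>
        norm (2 * (cmod (G i 0 \<omega>) ^ 4 + cmod (G j 0 \<omega>) ^ 4) + 2)"
      by (intro AE_I2) (auto intro: order_trans[OF _ abs_ge_self])
    have [measurable]: "(\<lambda>\<omega>. of_bool (i = j) :: complex) \<in> borel_measurable N" by simp
    show "(\<lambda>\<omega>. (cmod (G i 0 \<omega> * cnj (G j 0 \<omega>) - of_bool (i = j)))\<^sup>2) \<in> borel_measurable N"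
      by measurable
  qed
qed

end

section \<open>Coupling the Haar measure with a Gaussian matrix\<close>

text \<open>
  Parseval's identity.
\<close>
lemma sum_cmod_sq_orthonormal_combination:
  fixes u :: "nat \<Rightarrow> nat \<Rightarrow> complex"
  assumes "\<And>j j'. j < k \<Longrightarrow> j' < k \<Longrightarrow> (\<Sum>a<n. u a j * cnj (u a j')) = of_bool (j = j')"
  shows "(\<Sum>a<n. (cmod (\<Sum>j<k. w j * u a j))\<^sup>2) = (\<Sum>j<k. (cmod (w j))\<^sup>2)"
proof -
  have "complex_of_real (\<Sum>a<n. (cmod (\<Sum>j<k. w j * u a j))\<^sup>2) =
      (\<Sum>a<n. \<Sum>j<k. \<Sum>j'<k. (w j * u a j) * cnj (w j' * u a j'))"
    unfolding of_real_sum complex_norm_square cnj_sum sum_product ..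
  also have "\<dots> = (\<Sum>j<k. \<Sum>j'<k. \<Sum>a<n. (w j * u a j) * cnj (w j' * u a j'))"
    by (subst sum.swap) (rule sum.cong[OF refl], rule sum.swap)
  also have "\<dots> = (\<Sum>j<k. \<Sum>j'<k. w j * cnj (w j') * (\<Sum>a<n. u a j * cnj (u a j')))"
    by (intro sum.cong refl) (simp add: sum_distrib_left mult_ac)
  also have "\<dots> = (\<Sum>j<k. \<Sum>j'<k. if j' = j then w j * cnj (w j) else 0)"
    by (intro sum.cong refl) (use assms in auto)
  also have "\<dots> = (\<Sum>j<k. w j * cnj (w j))"
    by simp
  also have "\<dots> = complex_of_real (\<Sum>j<k. (cmod (w j))\<^sup>2)"
    unfolding of_real_sum complex_norm_square ..
  finally show ?thesis by (simp only: of_real_eq_iff)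
qed

context complex_gaussian_matrix
begin

lemma G0_component_measurable:
  assumes "i < k" "a < n"
  shows "(\<lambda>x. G i 0 (x a)) \<in> borel_measurable (PiM {..<n::nat} (\<lambda>_. N))"
proof -
  have "(\<lambda>x. x a) \<in> measurable (PiM {..<n} (\<lambda>_. N)) N"
    using assms by (intro measurable_component_singleton) auto
  moreover have "G i 0 \<in> borel_measurable N"
    using assms by (intro G_measurable) auto
  ultimately show ?thesis by (rule measurable_compose)
qed

text \<open>
  Unitary invariance of the standard complex Gaussian: the characteristic function is a function
  of the Euclidean norm of the frequency alone, and by Parseval's identity orthonormal columns preserve
  this norm.
\<close>
lemma gaussian_rows_times_orthonormal_columns:
  fixes u :: "nat \<Rightarrow> nat \<Rightarrow> complex"
  assumes h: "array_test_function ({..<k} \<times> {..<k}) h"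
    and u: "\<And>j j'. j < k \<Longrightarrow> j' < k \<Longrightarrow> (\<Sum>a<n. u a j * cnj (u a j')) = of_bool (j = j')"
  shows "(\<integral>x. h (\<lambda>(i, j). \<Sum>a<n. G i 0 (x a) * u a j) \<partial>PiM {..<n} (\<lambda>_. N)) = (\<integral>\<omega>. h (\<lambda>(i, j). G i j \<omega>) \<partial>N)"
proof (cases "k = 0")
  case True
  interpret Z: prob_space "PiM {..<n} (\<lambda>_. N)"
    by (rule prob_space_PiM) (rule prob_space_axioms)
  have c: "h x = h (\<lambda>_. 0)" for x
    by (rule array_test_function_cong[OF h]) (use True in auto)
  show ?thesis by (subst (1 2) c) (simp add: prob_space Z.prob_space)
next
  case False
  then have k: "k > 0" by simp
  let ?P = "{..<k} \<times> {..<k}" and ?Z = "PiM {..<n} (\<lambda>_. N)"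
  interpret P: product_sigma_finite "\<lambda>_::nat. N" by standard
  have Z: "prob_space ?Z" by (rule prob_space_PiM) (rule prob_space_axioms)
  define X where "X p x = (case p of (i, j) \<Rightarrow> \<Sum>a<n. G i 0 (x a) * u a j)" for p and x :: "nat \<Rightarrow> 'b"
  define Y where "Y p \<omega> = (case p of (i, j) \<Rightarrow> G i j \<omega>)" for p \<omega>
  have "(\<integral>x. h (\<lambda>p. X p x) \<partial>?Z) = (\<integral>\<omega>. h (\<lambda>p. Y p \<omega>) \<partial>N)"
  proof (rule expectation_array_eq_of_char_eq[OF Z prob_space_axioms _ _ _ _ h])
    fix p assume "p \<in> ?P"
    then obtain i j where ij: "p = (i, j)" "i < k" "j < k" by auto
    show "X p \<in> borel_measurable ?Z"
      unfolding X_def ij prod.case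
      by (intro borel_measurable_sum borel_measurable_times borel_measurable_const G0_component_measurable ij) auto
    show "Y p \<in> borel_measurable N"
      unfolding Y_def ij prod.case using G_measurable[OF ij(2,3)] by simp
  next
    fix w :: "nat \<times> nat \<Rightarrow> complex"
    define v where "v a i = (\<Sum>j<k. w (i, j) * u a j)" for a i
    let ?f = "\<lambda>a y. iexp (\<Sum>i<k. Re (v a i * G i 0 y))"
    have "(\<Sum>p\<in>?P. Re (w p * X p x)) = (\<Sum>a<n. \<Sum>i<k. Re (v a i * G i 0 (x a)))" for x
    proof -
      have entry: "Re (w (i, j) * X (i, j) x) = (\<Sum>a<n. Re (w (i, j) * u a j * G i 0 (x a)))" for i j
        unfolding X_def prod.case sum_distrib_left Re_sum by (simp only: mult_ac)
      have "(\<Sum>p\<in>?P. Re (w p * X p x)) = (\<Sum>(i, j)\<in>?P. Re (w (i, j) * X (i, j) x))"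
        by (intro sum.cong) auto
      also have "\<dots> = (\<Sum>i<k. \<Sum>j<k. Re (w (i, j) * X (i, j) x))"
        by (rule sum.cartesian_product[symmetric])
      also have "\<dots> = (\<Sum>i<k. \<Sum>j<k. \<Sum>a<n. Re (w (i, j) * u a j * G i 0 (x a)))"
        by (simp only: entry)
      also have "\<dots> = (\<Sum>i<k. \<Sum>a<n. \<Sum>j<k. Re (w (i, j) * u a j * G i 0 (x a)))"
        by (rule sum.cong[OF refl], rule sum.swap)
      also have "\<dots> = (\<Sum>a<n. \<Sum>i<k. \<Sum>j<k. Re (w (i, j) * u a j * G i 0 (x a)))"
        by (rule sum.swap)
      finally show ?thesis unfolding v_def sum_distrib_right Re_sum .
    qed
    then have "iexp (\<Sum>p\<in>?P. Re (w p * X p x)) = (\<Prod>a<n. ?f a (x a))" for x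
      by (simp only: of_real_sum[of _ "{..<n}"] sum_distrib_left[of _ _ "{..<n}"] exp_sum finite_lessThan)
    then have "(\<integral>x. iexp (\<Sum>p\<in>?P. Re (w p * X p x)) \<partial>?Z) = (\<integral>x. (\<Prod>a<n. ?f a (x a)) \<partial>?Z)"
      by (simp only:)
    also have "\<dots> = (\<Prod>a<n. \<integral>y. ?f a y \<partial>N)"
    proof (rule P.product_integral_prod)
      fix a
      have "(\<lambda>y. \<Sum>i<k. Re (v a i * G i 0 y)) \<in> borel_measurable N"
        using G_measurable[OF _ k] by (intro borel_measurable_sum borel_measurable_Re borel_measurable_times) auto
      then have "(\<lambda>y. complex_of_real (\<Sum>i<k. Re (v a i * G i 0 y))) \<in> borel_measurable N"
        by (rule measurable_compose) (rule borel_measurable_of_real)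
      then show "integrable N (?f a)"
        by (rule integrable_iexp) (simp only: Im_complex_of_real)
    qed simp
    also have "\<dots> = of_real (\<Prod>a<n. exp (- (\<Sum>i<k. (cmod (v a i))\<^sup>2) / 4))"
      unfolding of_real_prod by (intro prod.cong refl G_column_char k)
    also have "(\<Prod>a<n. exp (- (\<Sum>i<k. (cmod (v a i))\<^sup>2) / 4)) = exp (\<Sum>a<n. - (\<Sum>i<k. (cmod (v a i))\<^sup>2) / 4)"
      by (simp only: exp_sum finite_lessThan)
    also have "(\<Sum>a<n. - (\<Sum>i<k. (cmod (v a i))\<^sup>2) / 4) = - (\<Sum>a<n. \<Sum>i<k. (cmod (v a i))\<^sup>2) / 4"
      by (simp only: sum_divide_distrib[symmetric] sum_negf)
    also have "(\<Sum>a<n. \<Sum>i<k. (cmod (v a i))\<^sup>2) = (\<Sum>i<k. \<Sum>a<n. (cmod (v a i))\<^sup>2)"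
      by (rule sum.swap)
    also have "\<dots> = (\<Sum>i<k. \<Sum>j<k. (cmod (w (i, j)))\<^sup>2)"
      unfolding v_def by (intro sum.cong refl sum_cmod_sq_orthonormal_combination u)
    also have "\<dots> = (\<Sum>p\<in>?P. (cmod (w p))\<^sup>2)"
      unfolding sum.cartesian_product by (intro sum.cong) auto
    also have "of_real (exp (- (\<Sum>p\<in>?P. (cmod (w p))\<^sup>2) / 4)) = (\<integral>\<omega>. iexp (\<Sum>(i, j)\<in>?P. Re (w (i, j) * G i j \<omega>)) \<partial>N)"
      by (rule G_char[symmetric])
    also have "\<dots> = (\<integral>\<omega>. iexp (\<Sum>p\<in>?P. Re (w p * Y p \<omega>)) \<partial>N)"
      by (simp add: Y_def case_prod_unfold)
    finally show "(\<integral>x. iexp (\<Sum>p\<in>?P. Re (w p * X p x)) \<partial>?Z) = (\<integral>\<omega>. iexp (\<Sum>p\<in>?P. Re (w p * Y p \<omega>)) \<partial>N)" .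
  qed simp
  then show ?thesis by (simp only: X_def Y_def)
qed

text \<open>
  The squared Frobenius distance between the identity and the Gram matrix of the rows of
  $z / \sqrt n$.
\<close>
definition gram_deviation :: "nat \<Rightarrow> (nat \<Rightarrow> 'b) \<Rightarrow> real" where
  "gram_deviation n x = (\<Sum>(i, j)\<in>{..<k} \<times> {..<k}.
     (cmod (cinner n (\<lambda>a. G i 0 (x a) / sqrt n) (\<lambda>a. G j 0 (x a) / sqrt n) - of_bool (i = j)))\<^sup>2)"

definition column_covariance_variance :: real where
  "column_covariance_variance = (\<Sum>(i, j)\<in>{..<k} \<times> {..<k}.
     \<integral>y. (cmod (G i 0 y * cnj (G j 0 y) - of_bool (i = j)))\<^sup>2 \<partial>N)"

lemma gram_deviation_nonneg: "0 \<le> gram_deviation n x"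
  unfolding gram_deviation_def by (intro sum_nonneg) auto

text \<open>
  Each entry of the Gram matrix is an average of \<^term>\<open>n\<close> independent copies of
  \<open>G i 0 * cnj (G j 0)\<close>, whose mean is the corresponding entry of the identity, so its variance is of
  order \<open>1 / n\<close>.
\<close>
lemma expectation_gram_deviation:
  assumes "n > 0"
  shows "integrable (PiM {..<n} (\<lambda>_. N)) (gram_deviation n)"
    and "(\<integral>x. gram_deviation n x \<partial>PiM {..<n} (\<lambda>_. N)) = column_covariance_variance / n"
proof -
  let ?P = "{..<k} \<times> {..<k}" and ?Z = "PiM {..<n} (\<lambda>_. N)"
  define W where "W p y = G (fst p) 0 y * cnj (G (snd p) 0 y) - of_bool (fst p = snd p)" for p y
  have entry: "cinner n (\<lambda>a. G i 0 (x a) / sqrt n) (\<lambda>a. G j 0 (x a) / sqrt n) - of_bool (i = j) =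
      (\<Sum>a<n. W (i, j) (x a)) / n" for i j x
  proof -
    have "complex_of_real (sqrt n) * complex_of_real (sqrt n) = of_nat n"
      by (simp flip: of_real_mult)
    then have "cinner n (\<lambda>a. G i 0 (x a) / sqrt n) (\<lambda>a. G j 0 (x a) / sqrt n) =
        (\<Sum>a<n. G i 0 (x a) * cnj (G j 0 (x a))) / n"
      by (simp add: cinner_def sum_divide_distrib)
    moreover have "(\<Sum>a<n. W (i, j) (x a)) = (\<Sum>a<n. G i 0 (x a) * cnj (G j 0 (x a))) - n * of_bool (i = j)"
      by (simp add: W_def sum_subtractf)
    ultimately show ?thesis using assms by (simp add: diff_divide_distrib)
  qed
  have dev: "gram_deviation n x = (\<Sum>p\<in>?P. (cmod (\<Sum>a<n. W p (x a)))\<^sup>2 / n\<^sup>2)" for x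
    unfolding gram_deviation_def entry
    by (intro sum.cong) (auto simp: norm_divide power_divide)
  have W: "W p \<in> borel_measurable N" "integrable N (\<lambda>y. (cmod (W p y))\<^sup>2)" "(\<integral>y. W p y \<partial>N) = 0"
    if p: "p \<in> ?P" for p
  proof -
    have ij: "fst p < k" "snd p < k" and k: "0 < k" using p by auto
    note cov = G_column_covariance[OF ij]
    show "integrable N (\<lambda>y. (cmod (W p y))\<^sup>2)"
      using cov(3) by (simp only: W_def)
    have "integrable N (\<lambda>y. G (fst p) 0 y * cnj (G (snd p) 0 y) - of_bool (fst p = snd p))"
      by (intro Bochner_Integration.integrable_diff cov(1)) simp
    then show "W p \<in> borel_measurable N"
      by (simp add: W_def[abs_def] borel_measurable_integrable)
    show "(\<integral>y. W p y \<partial>N) = 0"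
      unfolding W_def using cov(1,2) by (simp add: prob_space)
  qed
  note LLN = iid_centered_sum_second_moment[OF prob_space_axioms W]
  show "integrable ?Z (gram_deviation n)"
    unfolding dev[abs_def]
    by (intro Bochner_Integration.integrable_sum integrable_divide LLN(1))
  have "(\<integral>x. gram_deviation n x \<partial>?Z) = (\<Sum>p\<in>?P. (\<integral>x. (cmod (\<Sum>a<n. W p (x a)))\<^sup>2 / n\<^sup>2 \<partial>?Z))"
    unfolding dev by (intro Bochner_Integration.integral_sum integrable_divide LLN(1))
  also have "\<dots> = (\<Sum>p\<in>?P. (\<integral>y. (cmod (W p y))\<^sup>2 \<partial>N) / n)"
    by (intro sum.cong refl) (use LLN(2) assms in \<open>auto simp: power2_eq_square\<close>)
  also have "\<dots> = column_covariance_variance / n"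
    unfolding column_covariance_variance_def sum_divide_distrib
    by (intro sum.cong) (auto simp: W_def)
  finally show "(\<integral>x. gram_deviation n x \<partial>?Z) = column_covariance_variance / n" .
qed

text \<open>
  The coupling. Where the Gram matrix of the rows deviates from the identity by more than \<^term>\<open>\<delta>\<close> in
  some entry, the trivial bound \<open>2 * B\<close> is dominated by a multiple of the squared deviation, as in
  Chebyshev's inequality; elsewhere the estimate for nearly orthonormal rows applies.
\<close>
lemma haar_block_gaussian_error:
  fixes M :: "'a measure"
  assumes U: "haar_random_unitary M n U" and n: "n > 0"
    and h: "array_test_function ({..<k} \<times> {..<k}) h" and B: "B > 0" "\<And>x. \<bar>h x\<bar> \<le> B"
    and "K \<ge> 0" "e > 0"
    and modulus: "\<And>x y. \<bar>h x - h y\<bar> \<le> e * (1 + (\<Sum>p\<in>{..<k} \<times> {..<k}. (cmod (y p))\<^sup>2))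
        + K * (\<Sum>p\<in>{..<k} \<times> {..<k}. (cmod (x p - y p))\<^sup>2)"
    and "\<delta> > 0"
    and close: "\<And>w. (\<And>i j. i < k \<Longrightarrow> j < k \<Longrightarrow> cmod (cinner n (w i) (w j) - of_bool (i = j)) \<le> \<delta>) \<Longrightarrow>
      \<exists>q. orthonormal_on n {..<k} q \<and> (\<forall>i<k. cnorm n (\<lambda>a. w i a - q i a) \<le> \<eta>)"
    and r: "inj_on r {..<k}" "r ` {..<k} \<subseteq> {..<n}" and c: "inj_on c {..<k}" "c ` {..<k} \<subseteq> {..<n}"
  shows "\<bar>(\<integral>\<omega>. h (\<lambda>(i, j). G i j \<omega>) \<partial>N) - (\<integral>\<omega>. h (\<lambda>(i, j). sqrt n * U \<omega> $$ (r i, c j)) \<partial>M)\<bar>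
    \<le> e * (1 + real k ^ 2) + K * (real k ^ 2 * \<eta>\<^sup>2) + 2 * B / \<delta>\<^sup>2 * (column_covariance_variance / n)"
proof -
  interpret U: haar_random_unitary M n U by fact
  let ?P = "{..<k} \<times> {..<k}" and ?Z = "PiM {..<n} (\<lambda>_. N)"
  interpret Z: prob_space ?Z by (rule prob_space_PiM) (rule prob_space_axioms)
  interpret ZM: pair_prob_space ?Z M by standard
  have cn: "c j < n" if "j < k" for j using c that by auto
  define F where "F x \<omega> = h (\<lambda>(i, j). \<Sum>a<n. G i 0 (x a) * U \<omega> $$ (a, c j))" for x \<omega>
  define EG where "EG = (\<integral>\<omega>. h (\<lambda>(i, j). G i j \<omega>) \<partial>N)"
  define EU where "EU = (\<integral>\<omega>. h (\<lambda>(i, j). sqrt n * U \<omega> $$ (r i, c j)) \<partial>M)"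
  define A where "A = e * (1 + real k ^ 2) + K * (real k ^ 2 * \<eta>\<^sup>2)"
  have A0: "A \<ge> 0" unfolding A_def using \<open>K \<ge> 0\<close> \<open>e > 0\<close> by simp
  have Fm: "case_prod F \<in> borel_measurable (?Z \<Otimes>\<^sub>M M)"
  proof -
    have "(\<lambda>z. h (\<lambda>(i, j). \<Sum>a<n. G i 0 (fst z a) * U (snd z) $$ (a, c j))) \<in> borel_measurable (?Z \<Otimes>\<^sub>M M)"
    proof (rule array_test_function_measurable[OF h])
      fix p assume "p \<in> ?P"
      then obtain i j where ij: "p = (i, j)" "i < k" "j < k" by auto
      have "(\<lambda>z. G i 0 (fst z a)) \<in> borel_measurable (?Z \<Otimes>\<^sub>M M)" if "a < n" for a
        by (rule measurable_compose[OF measurable_fst G0_component_measurable[OF ij(2) that]])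
      moreover have "(\<lambda>z. U (snd z) $$ (a, c j)) \<in> borel_measurable (?Z \<Otimes>\<^sub>M M)" if "a < n" for a
        by (rule measurable_compose[OF measurable_snd U.entry_measurable[OF that cn[OF ij(3)]]])
      ultimately show "(\<lambda>z. case p of (i, j) \<Rightarrow> \<Sum>a<n. G i 0 (fst z a) * U (snd z) $$ (a, c j)) \<in> borel_measurable (?Z \<Otimes>\<^sub>M M)"
        unfolding ij prod.case by (intro borel_measurable_sum borel_measurable_times) auto
    qed
    then show ?thesis by (simp add: F_def case_prod_unfold)
  qed
  have Fint: "integrable (?Z \<Otimes>\<^sub>M M) (case_prod F)"
    by (rule ZM.P.integrable_const_bound[of _ B]) (use B Fm in \<open>auto simp: F_def\<close>)
  \<comment> \<open>averaging over the Gaussian rows first gives exactly the Gaussian law\<close>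
  have rows: "(\<integral>x. F x \<omega> \<partial>?Z) = EG" if \<omega>: "\<omega> \<in> space M" for \<omega>
    unfolding F_def EG_def
  proof (rule gaussian_rows_times_orthonormal_columns[OF h])
    fix j j' assume jj: "j < k" "j' < k"
    have "c j = c j' \<longleftrightarrow> j = j'" using c(1) jj by (auto simp: inj_on_eq_iff)
    then show "(\<Sum>a<n. U \<omega> $$ (a, c j) * cnj (U \<omega> $$ (a, c j'))) = of_bool (j = j')"
      using unitary_columns_orthonormal[OF U.U_unitary[OF \<omega>] cn[OF jj(1)] cn[OF jj(2)]] by simp
  qed
  have "EG = (\<integral>\<omega>. (\<integral>x. F x \<omega> \<partial>?Z) \<partial>M)"
  proof -
    have "(\<integral>\<omega>. (\<integral>x. F x \<omega> \<partial>?Z) \<partial>M) = (\<integral>\<omega>. EG \<partial>M)"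
      by (rule Bochner_Integration.integral_cong[OF refl rows])
    then show ?thesis by (simp add: U.prob_space)
  qed
  also have "\<dots> = (\<integral>x. (\<integral>\<omega>. F x \<omega> \<partial>M) \<partial>?Z)"
    by (rule ZM.Fubini_integral[OF Fint])
  finally have fub: "EG = (\<integral>x. (\<integral>\<omega>. F x \<omega> \<partial>M) \<partial>?Z)" .
  have innerint: "integrable ?Z (\<lambda>x. \<integral>\<omega>. F x \<omega> \<partial>M)"
    using ZM.integrable_fst[OF Fint] by simp
  have EUB: "\<bar>EU\<bar> \<le> B" and FB: "\<bar>\<integral>\<omega>. F x \<omega> \<partial>M\<bar> \<le> B" for x
  proof -
    have "\<bar>\<integral>\<omega>. f \<omega> \<partial>M\<bar> \<le> B" if "\<And>\<omega>. \<bar>f \<omega>\<bar> \<le> B" for f :: "'a \<Rightarrow> real"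
    proof (cases "integrable M f")
      case True
      have "\<bar>\<integral>\<omega>. f \<omega> \<partial>M\<bar> \<le> (\<integral>\<omega>. \<bar>f \<omega>\<bar> \<partial>M)" by (rule integral_abs_bound)
      also have "\<dots> \<le> (\<integral>\<omega>. B \<partial>M)" using True that by (intro integral_mono) auto
      finally show ?thesis by (simp add: U.prob_space)
    qed (use B(1) in \<open>simp add: not_integrable_integral_eq\<close>)
    then show "\<bar>EU\<bar> \<le> B" "\<bar>\<integral>\<omega>. F x \<omega> \<partial>M\<bar> \<le> B"
      unfolding EU_def F_def using B(2) by auto
  qed
  \<comment> \<open>averaging over the unitary matrix first, for a fixed realization of the rows\<close>
  have fixed: "\<bar>(\<integral>\<omega>. F x \<omega> \<partial>M) - EU\<bar> \<le> A + 2 * B / \<delta>\<^sup>2 * gram_deviation n x" for x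
  proof -
    define w where "w i a = G i 0 (x a) / sqrt n" for i a
    have wF: "F x \<omega> = h (\<lambda>(i, j). sqrt n * (\<Sum>a<n. w i a * U \<omega> $$ (a, c j)))" for \<omega>
      unfolding F_def
      by (rule array_test_function_cong[OF h]) (use n in \<open>auto simp: w_def sum_distrib_left\<close>)
    have dev: "gram_deviation n x = (\<Sum>(i, j)\<in>?P. (cmod (cinner n (w i) (w j) - of_bool (i = j)))\<^sup>2)"
      by (simp add: gram_deviation_def w_def[abs_def])
    have D0: "0 \<le> 2 * B / \<delta>\<^sup>2 * gram_deviation n x"
      using B(1) gram_deviation_nonneg by simp
    show ?thesis
    proof (cases "\<forall>i<k. \<forall>j<k. cmod (cinner n (w i) (w j) - of_bool (i = j)) \<le> \<delta>")
      case True
      then obtain q where q: "orthonormal_on n {..<k} q" "\<And>i. i < k \<Longrightarrow> cnorm n (\<lambda>a. w i a - q i a) \<le> \<eta>"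
        using close[of w] by auto
      have "\<bar>(\<integral>\<omega>. F x \<omega> \<partial>M) - EU\<bar> \<le> A"
        unfolding wF EU_def A_def
        by (rule U.near_orthonormal_rows_estimate[OF h \<open>K \<ge> 0\<close> \<open>e > 0\<close> modulus q r c(2) n])
      then show ?thesis using D0 by linarith
    next
      case False
      then obtain i j where ij: "i < k" "j < k" "\<delta> < cmod (cinner n (w i) (w j) - of_bool (i = j))"
        by (auto simp: not_le)
      have "\<delta>\<^sup>2 \<le> (cmod (cinner n (w i) (w j) - of_bool (i = j)))\<^sup>2"
        using ij(3) \<open>\<delta> > 0\<close> by (intro power_mono) auto
      also have "\<dots> \<le> gram_deviation n x"
        unfolding dev using ij
        by (intro member_le_sum[of "(i, j)" ?P "\<lambda>(i, j). (cmod (cinner n (w i) (w j) - of_bool (i = j)))\<^sup>2", simplified prod.case]) auto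
      finally have "2 * B / \<delta>\<^sup>2 * \<delta>\<^sup>2 \<le> 2 * B / \<delta>\<^sup>2 * gram_deviation n x"
        using B(1) by (intro mult_left_mono) auto
      then have "2 * B \<le> 2 * B / \<delta>\<^sup>2 * gram_deviation n x" using \<open>\<delta> > 0\<close> by simp
      moreover have "\<bar>(\<integral>\<omega>. F x \<omega> \<partial>M) - EU\<bar> \<le> 2 * B" using EUB FB[of x] by linarith
      ultimately show ?thesis using A0 by linarith
    qed
  qed
  have "EG - EU = (\<integral>x. (\<integral>\<omega>. F x \<omega> \<partial>M) - EU \<partial>?Z)"
    using fub innerint by (simp add: Z.prob_space)
  then have "\<bar>EG - EU\<bar> \<le> (\<integral>x. \<bar>(\<integral>\<omega>. F x \<omega> \<partial>M) - EU\<bar> \<partial>?Z)"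
    by (simp only: integral_abs_bound)
  also have "\<dots> \<le> (\<integral>x. A + 2 * B / \<delta>\<^sup>2 * gram_deviation n x \<partial>?Z)"
    using innerint expectation_gram_deviation(1)[OF n]
    by (intro integral_mono fixed integrable_abs Bochner_Integration.integrable_diff
        Bochner_Integration.integrable_add integrable_mult_right) auto
  also have "\<dots> = A + 2 * B / \<delta>\<^sup>2 * (column_covariance_variance / n)"
    using expectation_gram_deviation[OF n] by (simp add: Z.prob_space)
  finally show ?thesis unfolding EG_def EU_def A_def .
qed

text \<open>
  Order of choices: \<open>e\<close> first, then the constant \<open>K\<close> of the quadratic modulus, then the distance
  \<open>\<eta>\<close> allowed between the rows and an orthonormal family, then \<open>\<delta>\<close>, and finally \<open>n\<close>. Each of the
  three error terms becomes at most a quarter of \<open>E\<close>.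
\<close>
lemma haar_block_tendsto:
  fixes M :: "nat \<Rightarrow> 'a measure"
  assumes k: "k > 0" and U: "\<And>n. n \<ge> k \<Longrightarrow> haar_random_unitary (M n) n (U n)"
    and h: "array_test_function ({..<k} \<times> {..<k}) h"
    and r: "\<And>n. n \<ge> k \<Longrightarrow> inj_on (r n) {..<k} \<and> r n ` {..<k} \<subseteq> {..<n}"
    and c: "\<And>n. n \<ge> k \<Longrightarrow> inj_on (c n) {..<k} \<and> c n ` {..<k} \<subseteq> {..<n}"
  shows "(\<lambda>n. \<integral>\<omega>. h (\<lambda>(i, j). sqrt n * U n \<omega> $$ (r n i, c n j)) \<partial>M n) \<longlonglongrightarrow> (\<integral>\<omega>. h (\<lambda>(i, j). G i j \<omega>) \<partial>N)"
proof (rule LIMSEQ_I)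
  fix E :: real assume E: "E > 0"
  obtain B where B: "B > 0" "\<And>x. \<bar>h x\<bar> \<le> B" using array_test_function_bound[OF h] by metis
  define e where "e = E / (4 * (1 + real k ^ 2))"
  have k2: "1 + real k ^ 2 > 0" by (simp add: add_pos_nonneg)
  have quarter: "E / (4 * s) * s = E / 4" if "s > 0" for s
    using that by simp
  have e: "e > 0" "e * (1 + real k ^ 2) = E / 4"
    using E k2 quarter[OF k2] by (simp_all only: e_def) simp
  obtain K where K: "K \<ge> 0" "\<And>x y. \<bar>h x - h y\<bar> \<le> e * (1 + (\<Sum>p\<in>{..<k} \<times> {..<k}. (cmod (y p))\<^sup>2))
        + K * (\<Sum>p\<in>{..<k} \<times> {..<k}. (cmod (x p - y p))\<^sup>2)"
    by (rule array_test_function_quadratic_modulus[OF h _ e(1)]) (simp, rule that)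
  define \<eta> where "\<eta> = sqrt (E / (4 * (K * real k ^ 2 + 1)))"
  have Kk: "K * real k ^ 2 + 1 > 0" using K(1) by (simp add: add_nonneg_pos)
  have \<eta>: "\<eta> > 0" using E Kk by (simp add: \<eta>_def)
  have \<eta>2: "K * (real k ^ 2 * \<eta>\<^sup>2) \<le> E / 4"
  proof -
    have "(K * real k ^ 2 + 1) * \<eta>\<^sup>2 = E / 4"
      using E Kk quarter[OF Kk] by (simp add: \<eta>_def mult.commute)
    moreover have "K * (real k ^ 2 * \<eta>\<^sup>2) \<le> (K * real k ^ 2 + 1) * \<eta>\<^sup>2"
      by (simp add: algebra_simps)
    ultimately show ?thesis by simp
  qed
  from near_orthonormal_close_to_orthonormal[OF \<eta>, of k] obtain \<delta> where \<delta>: "\<delta> > 0"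
    "\<forall>n w. (\<forall>i<k. \<forall>j<k. cmod (cinner n (w i) (w j) - of_bool (i = j)) \<le> \<delta>) \<longrightarrow>
      (\<exists>q. orthonormal_on n {..<k} q \<and> (\<forall>i<k. cnorm n (\<lambda>a. w i a - q i a) \<le> \<eta>))"
    by (elim exE conjE)
  have "(\<lambda>n. 2 * B / \<delta>\<^sup>2 * (column_covariance_variance / real n)) \<longlonglongrightarrow> 2 * B / \<delta>\<^sup>2 * 0"
    by (intro tendsto_mult_left lim_const_over_n)
  then have "\<forall>\<^sub>F n in sequentially. 2 * B / \<delta>\<^sup>2 * (column_covariance_variance / real n) < E / 4"
    by (rule order_tendstoD) (use E in simp)
  then obtain n0 where n0: "\<And>n. n \<ge> n0 \<Longrightarrow> 2 * B / \<delta>\<^sup>2 * (column_covariance_variance / real n) < E / 4"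
    by (auto simp: eventually_sequentially)
  show "\<exists>n0. \<forall>n\<ge>n0. norm ((\<integral>\<omega>. h (\<lambda>(i, j). sqrt n * U n \<omega> $$ (r n i, c n j)) \<partial>M n) - (\<integral>\<omega>. h (\<lambda>(i, j). G i j \<omega>) \<partial>N)) < E"
  proof (intro exI[of _ "max n0 k"] allI impI)
    fix n assume "n \<ge> max n0 k"
    then have n: "n \<ge> n0" "n \<ge> k" "n > 0" using k by auto
    have "\<bar>(\<integral>\<omega>. h (\<lambda>(i, j). G i j \<omega>) \<partial>N) - (\<integral>\<omega>. h (\<lambda>(i, j). sqrt n * U n \<omega> $$ (r n i, c n j)) \<partial>M n)\<bar>
      \<le> e * (1 + real k ^ 2) + K * (real k ^ 2 * \<eta>\<^sup>2) + 2 * B / \<delta>\<^sup>2 * (column_covariance_variance / n)"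
      using r[OF n(2)] c[OF n(2)] \<delta>(2)
      by (intro haar_block_gaussian_error[OF U[OF n(2)] n(3) h B K(1) e(1) K(2) \<delta>(1)]) auto
    also have "\<dots> < E" using e(2) \<eta>2 n0[OF n(1)] E by linarith
    finally show "norm ((\<integral>\<omega>. h (\<lambda>(i, j). sqrt n * U n \<omega> $$ (r n i, c n j)) \<partial>M n) - (\<integral>\<omega>. h (\<lambda>(i, j). G i j \<omega>) \<partial>N)) < E"
      by (simp add: abs_minus_commute)
  qed
qed

end

theorem theorem1:
  fixes k :: nat
    and M :: "nat \<Rightarrow> 'a measure" and U :: "nat \<Rightarrow> 'a \<Rightarrow> complex mat"
    and N :: "'b measure" and G :: "nat \<Rightarrow> nat \<Rightarrow> 'b \<Rightarrow> complex"
  assumes "k \<ge> 1"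
    and "\<And>n. n \<ge> k \<Longrightarrow> prob_space (M n)"
    and "\<And>n. n \<ge> k \<Longrightarrow> haar_unitary (M n) n (U n)"
    and "prob_space N"
    and "\<And>i j. i < k \<Longrightarrow> j < k \<Longrightarrow> complex_gaussian N 1 (G i j)"
    and "prob_space.indep_vars N (\<lambda>_. borel) (\<lambda>(i, j). G i j) ({..<k} \<times> {..<k})"
  shows "converges_in_distribution (mat_topology k k)
           M (\<lambda>n \<omega>. mat k k (\<lambda>(i, j). complex_of_real (sqrt (real n)) * U n \<omega> $$ (i, j)))
           N (\<lambda>\<omega>. mat k k (\<lambda>(i, j). G i j \<omega>))
       \<and> (\<forall>r c :: nat \<Rightarrow> nat \<Rightarrow> nat.
            (\<forall>n\<ge>k. strict_mono_on {..<k} (r n) \<and> r n ` {..<k} \<subseteq> {..<n} \<and>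
                   strict_mono_on {..<k} (c n) \<and> c n ` {..<k} \<subseteq> {..<n}) \<longrightarrow>
            converges_in_distribution (mat_topology k k)
              M (\<lambda>n \<omega>. mat k k (\<lambda>(i, j). complex_of_real (sqrt (real n)) * U n \<omega> $$ (r n i, c n j)))
              N (\<lambda>\<omega>. mat k k (\<lambda>(i, j). G i j \<omega>)))"
proof -
  interpret G: complex_gaussian_matrix N k G
    using assms by (simp add: complex_gaussian_matrix_def complex_gaussian_matrix_axioms_def)
  have U: "haar_random_unitary (M n) n (U n)" if "n \<ge> k" for n
    using assms(2,3)[OF that] by (simp add: haar_random_unitary_def haar_random_unitary_axioms_def)
  have block: "converges_in_distribution (mat_topology k k)
      M (\<lambda>n \<omega>. mat k k (\<lambda>(i, j). complex_of_real (sqrt (real n)) * U n \<omega> $$ (r n i, c n j)))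
      N (\<lambda>\<omega>. mat k k (\<lambda>(i, j). G i j \<omega>))"
    if r: "\<And>n. n \<ge> k \<Longrightarrow> inj_on (r n) {..<k} \<and> r n ` {..<k} \<subseteq> {..<n}"
      and c: "\<And>n. n \<ge> k \<Longrightarrow> inj_on (c n) {..<k} \<and> c n ` {..<k} \<subseteq> {..<n}"
    for r c :: "nat \<Rightarrow> nat \<Rightarrow> nat"
  proof -
    define X where "X n p \<omega> = (case p of (i, j) \<Rightarrow> complex_of_real (sqrt (real n)) * U n \<omega> $$ (r n i, c n j))" for n p \<omega>
    define Y where "Y p \<omega> = (case p of (i, j) \<Rightarrow> G i j \<omega>)" for p \<omega>
    have "converges_in_distribution (mat_topology k k) M (\<lambda>n \<omega>. mat k k (\<lambda>p. X n p \<omega>)) N (\<lambda>\<omega>. mat k k (\<lambda>p. Y p \<omega>))"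
    proof (rule converges_in_distribution_matI[where ?n0.0 = k])
      fix n p assume n: "n \<ge> k" and "p \<in> {..<k} \<times> {..<k}"
      then obtain i j where ij: "p = (i, j)" "i < k" "j < k" by auto
      interpret haar_random_unitary "M n" n "U n" by (rule U[OF n])
      have "r n i < n" "c n j < n" using r[OF n] c[OF n] ij by auto
      then show "X n p \<in> borel_measurable (M n)"
        unfolding X_def ij prod.case by (intro borel_measurable_times borel_measurable_const entry_measurable)
    next
      fix p assume "p \<in> {..<k} \<times> {..<k}"
      then show "Y p \<in> borel_measurable N"
        using G.G_measurable by (auto simp: Y_def[abs_def])
    next
      fix h :: "(nat \<times> nat \<Rightarrow> complex) \<Rightarrow> real" assume "array_test_function ({..<k} \<times> {..<k}) h"
      from G.haar_block_tendsto[OF _ U this r c] assms(1)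
      show "(\<lambda>n. \<integral>\<omega>. h (\<lambda>p. X n p \<omega>) \<partial>M n) \<longlonglongrightarrow> (\<integral>\<omega>. h (\<lambda>p. Y p \<omega>) \<partial>N)"
        unfolding X_def Y_def by simp
    qed
    then show ?thesis by (simp only: X_def Y_def)
  qed
  show ?thesis
  proof (intro conjI allI impI)
    show "converges_in_distribution (mat_topology k k)
      M (\<lambda>n \<omega>. mat k k (\<lambda>(i, j). complex_of_real (sqrt (real n)) * U n \<omega> $$ (i, j)))
      N (\<lambda>\<omega>. mat k k (\<lambda>(i, j). G i j \<omega>))"
      by (rule block[of "\<lambda>_ i. i" "\<lambda>_ j. j"]) auto
  next
    fix r c :: "nat \<Rightarrow> nat \<Rightarrow> nat"
    assume "\<forall>n\<ge>k. strict_mono_on {..<k} (r n) \<and> r n ` {..<k} \<subseteq> {..<n} \<and>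
                   strict_mono_on {..<k} (c n) \<and> c n ` {..<k} \<subseteq> {..<n}"
    then show "converges_in_distribution (mat_topology k k)
      M (\<lambda>n \<omega>. mat k k (\<lambda>(i, j). complex_of_real (sqrt (real n)) * U n \<omega> $$ (r n i, c n j)))
      N (\<lambda>\<omega>. mat k k (\<lambda>(i, j). G i j \<omega>))"
      by (intro block) (auto dest: strict_mono_on_imp_inj_on)
  qed
qed

end
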